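(* Let $f\in L^1[-\pi,\pi]$ with $f\ge 0$, and let $\alpha>0$. Suppose $u$ and $v$ solve the Poisson problems $$-u''=f \ \text{ in } (-\pi,\pi),\qquad -u'(-\pi)+\alpha u(-\pi)=u'(\pi)+\alpha u(\pi)=0,$$ $$-v''=f^{\#} \ \text{ in } (-\pi,\pi),\qquad -v'(-\pi)+\alpha v(-\pi)=v'(\pi)+\alpha v(\pi)=0,$$ where $f^{\#}$ is the symmetric decreasing rearrangement of $f$. Then $$\int_{-\pi}^{\pi}\phi(u)\,dx\le \int_{-\pi}^{\pi}\phi(v)\,dx$$ for each increasing convex function $\phi:\mathbb{R}\to\mathbb{R}$. In particular, $$\|u\|_{L^p[-\pi,\pi]}\le \|v\|_{L^p[-\pi,\pi]},\qquad 1\le p\le +\infty.$$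
   Context: Rearrangements: let $X\subseteq\mathbb{R}$ be a measurable set of finite length $|X|$ and $f\in L^1(X)$. The decreasing rearrangement $f^{\ast}:[0,|X|]\to[-\infty,+\infty]$ is defined by $f^{\ast}(0)=\operatorname{ess\,sup}_X f$, $f^{\ast}(t)=\inf\{s: |\{x\in X: s<f(x)\}|\le t\}$ for $t\in(0,|X|)$, and $f^{\ast}(|X|)=\operatorname{ess\,inf}_X f$. The symmetric decreasing rearrangement is $f^{\#}:[-\tfrac12|X|,\tfrac12|X|]\to[-\infty,+\infty]$, $f^{\#}(t)=f^{\ast}(2|t|)$. Here $X=[-\pi,\pi]$. Solutions: a solution of $-u''=f$ in $(-\pi,\pi)$ with the given boundary conditions means a function $u\in C^1[-\pi,\pi]$ such that $u'$ is absolutely continuous on $[-\pi,\pi]$, $-u''=f$ a.e. on $(-\pi,\pi)$, and the boundary conditions hold (such a solution exists and is unique for the Robin problem with $\alpha>0$). "Increasing" means nondecreasing. *)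

theory Defs
  imports "HOL-Analysis.Analysis" "HOL-Probability.Essential_Supremum"
begin

text \<open>Meant for Lebesgue measurable \<open>X\<close> of finite measure, \<open>f\<close> integrable on \<open>X\<close> and
  \<open>0 \<le> t \<le> |X|\<close>; values at other \<open>t\<close> carry no meaning. The essential infimum is written as
  \<open>- esssup (- f)\<close>.\<close>

definition decreasing_rearrangement :: "real set \<Rightarrow> (real \<Rightarrow> real) \<Rightarrow> real \<Rightarrow> ereal" where
  "decreasing_rearrangement X f t =
    (if t = 0 then esssup (lebesgue_on X) (\<lambda>x. ereal (f x))
     else if t = measure lebesgue X then - esssup (lebesgue_on X) (\<lambda>x. - ereal (f x))
     else Inf {ereal s | s. measure lebesgue {x \<in> X. s < f x} \<le> t})"

definition symmetric_decreasing_rearrangement :: "real set \<Rightarrow> (real \<Rightarrow> real) \<Rightarrow> real \<Rightarrow> ereal" where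
  "symmetric_decreasing_rearrangement X f t = decreasing_rearrangement X f (2 * \<bar>t\<bar>)"

text \<open>A division \<open>D\<close> is a finite set of nonempty compact intervals \<open>k = {Inf k..Sup k}\<close> with
  pairwise disjoint interiors, so this is the usual \<open>\<epsilon>\<close>-\<open>\<delta>\<close> definition.\<close>

definition absolutely_continuous_on :: "real set \<Rightarrow> (real \<Rightarrow> real) \<Rightarrow> bool" where
  "absolutely_continuous_on S g \<longleftrightarrow>
    (\<forall>\<epsilon>>0. \<exists>\<delta>>0. \<forall>D T. D division_of T \<longrightarrow> T \<subseteq> S \<longrightarrow> (\<Sum>k\<in>D. Sup k - Inf k) < \<delta> \<longrightarrow>
      (\<Sum>k\<in>D. \<bar>g (Sup k) - g (Inf k)\<bar>) < \<epsilon>)"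

text \<open>\<open>u\<close> solves \<open>- u'' = F\<close> on \<open>(a, b)\<close> with Robin boundary conditions. The derivative \<open>u'\<close> on
  \<open>[a, b]\<close> is one-sided at the endpoints. The right-hand side is extended-real valued because a
  rearrangement may take infinite values.\<close>

definition robin_poisson_solution ::
  "real \<Rightarrow> real \<Rightarrow> real \<Rightarrow> (real \<Rightarrow> ereal) \<Rightarrow> (real \<Rightarrow> real) \<Rightarrow> bool" where
  "robin_poisson_solution a b \<alpha> F u \<longleftrightarrow>
    (\<exists>u'. (\<forall>x\<in>{a..b}. (u has_real_derivative u' x) (at x within {a..b})) \<and>
          continuous_on {a..b} u' \<and>
          absolutely_continuous_on {a..b} u' \<and>
          (AE x in lebesgue_on {a<..<b}.
             \<exists>u''. (u' has_real_derivative u'') (at x) \<and> ereal (- u'') = F x) \<and>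
          - u' a + \<alpha> * u a = 0 \<and>
          u' b + \<alpha> * u b = 0)"

definition Lp_norm_on :: "real set \<Rightarrow> ennreal \<Rightarrow> (real \<Rightarrow> real) \<Rightarrow> ennreal" where
  "Lp_norm_on X p g =
    (if p = \<infinity> then esssup (lebesgue_on X) (\<lambda>x. ennreal \<bar>g x\<bar>)
     else let I = (\<integral>\<^sup>+ x. ennreal (\<bar>g x\<bar> powr enn2real p) \<partial>lebesgue_on X)
          in if I = \<infinity> then \<infinity> else ennreal (enn2real I powr (1 / enn2real p)))"

end

theory Submission
  imports Defs
begin

text \<open>Write \<open>[-L, L]\<close> for the interval. The Robin problem has the Green function
  \<open>G(x, y) = d - \<bar>x - y\<bar> / 2 - c x y\<close> with \<open>c = \<alpha> / (2 (1 + \<alpha> L))\<close> and a constant \<open>d\<close>. As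
  \<open>4 x y = (x + y)\<^sup>2 - (x - y)\<^sup>2\<close>, it splits into \<open>d + K\<^sub>1(x - y) + K\<^sub>2(x + y)\<close> where
  \<open>K\<^sub>1(t) = c t\<^sup>2 / 4 - \<bar>t\<bar> / 2\<close> and \<open>K\<^sub>2(t) = - c t\<^sup>2 / 4\<close>. Both kernels are symmetric decreasing on
  \<open>[-2 L, 2 L]\<close>; for \<open>K\<^sub>1\<close> this is the inequality \<open>2 c L = \<alpha> L / (1 + \<alpha> L) < 1\<close>. So for an interval
  \<open>I\<close> with midpoint \<open>s\<close>, the function \<open>y \<mapsto> \<integral>\<^sub>I G(x, y) dx\<close> is, up to a constant, the sum of a function
  decreasing symmetrically around \<open>s\<close> and one decreasing symmetrically around \<open>- s\<close>. Against
  \<open>f\<close> each of them integrates to at most what its translate to the origin gives against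
  \<open>f\<^sup>#\<close>. Hence \<open>\<integral>\<^sub>I u \<le> \<integral>\<^sub>J v\<close>, where \<open>J\<close> is the centred interval as long as \<open>I\<close>.

  The formal proof of this step, \<open>robin_interval_comparison\<close>, expresses all integrals
  through the drops of \<open>u'\<close> over intervals, that is, through the mass of \<open>f\<close> there. The one fact needed about the
  rearrangement is that \<open>f\<close> has at most as much mass in any interval as \<open>f\<^sup>#\<close> has in the centred
  interval of the same length (\<open>symmetric_rearrangement_interval\<close>), with equality for the whole interval. Masses become
  drops of \<open>u'\<close> and \<open>v'\<close> by the fundamental theorem of calculus for absolutely continuous functions
  (\<open>absolutely_continuous_on_has_integral\<close>).

  Since \<open>f \<ge> 0\<close>, the function \<open>u\<close> is concave and its superlevel sets are intervals. Integrating \<open>u - c\<close> over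
  \<open>{u > c}\<close> and comparing gives \<open>\<integral> (u - c)\<^sup>+ \<le> \<integral> (v - c)\<^sup>+\<close> for every \<open>c\<close>
  (\<open>integral_pos_part_le_of_interval_comparison\<close>). On a bounded range every increasing convex \<open>\<phi>\<close> is a uniform limit
  of constants plus nonnegative combinations of the functions \<open>t \<mapsto> (t - c)\<^sup>+\<close>, which gives the inequality for
  \<open>\<phi>\<close>. As \<open>u\<close> and \<open>v\<close> are nonnegative, \<open>\<phi>(t) = max(t, 0)\<^sup>p\<close> yields the finite \<open>L\<^sup>p\<close> norms, and
  \<open>c = ess sup \<bar>v\<bar>\<close> yields the sup norm.\<close>

section \<open>The fundamental theorem of calculus for absolutely continuous functions\<close>

lemma real_derivative_straddle:
  fixes g :: "real \<Rightarrow> real"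
  assumes "(g has_real_derivative D) (at x)" "e > 0"
  obtains d where "d > 0"
    "\<And>p q. \<lbrakk>p \<le> x; x \<le> q; x - p < d; q - x < d\<rbrakk> \<Longrightarrow> \<bar>g q - g p - D * (q - p)\<bar> \<le> e * (q - p)"
proof -
  have "(g has_derivative (*) D) (at x)"
    using assms(1) by (simp add: has_field_derivative_def)
  then obtain d where d: "d > 0" and
    dd: "\<And>y. norm (y - x) < d \<Longrightarrow> norm (g y - g x - D * (y - x)) \<le> e * norm (y - x)"
    using \<open>e > 0\<close> unfolding has_derivative_at_alt by blast
  show thesis
  proof (rule that[OF d])
    fix p q assume pq: "p \<le> x" "x \<le> q" "x - p < d" "q - x < d"
    have "\<bar>g q - g x - D * (q - x)\<bar> \<le> e * (q - x)" "\<bar>g p - g x - D * (p - x)\<bar> \<le> e * (x - p)"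
      using dd[of q] dd[of p] pq by auto
    then show "\<bar>g q - g p - D * (q - p)\<bar> \<le> e * (q - p)"
      by (simp add: algebra_simps abs_le_iff)
  qed
qed

text \<open>The definition of absolute continuity speaks of divisions, the gauge integral of tagged divisions. Both sums
  agree because an interval cannot carry two tags unless its interior is empty, and then it contributes zero.\<close>

lemma absolutely_continuous_on_tagged:
  assumes "absolutely_continuous_on S g" "e > 0"
  obtains d where "d > 0"
    "\<And>p T. \<lbrakk>p tagged_partial_division_of T; T \<subseteq> S; (\<Sum>(x,k)\<in>p. Sup k - Inf k) < d\<rbrakk>
        \<Longrightarrow> (\<Sum>(x,k)\<in>p. \<bar>g (Sup k) - g (Inf k)\<bar>) < e"
proof -
  obtain d where d: "d > 0" and dd: "\<And>D T. \<lbrakk>D division_of T; T \<subseteq> S; (\<Sum>k\<in>D. Sup k - Inf k) < d\<rbrakk>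
        \<Longrightarrow> (\<Sum>k\<in>D. \<bar>g (Sup k) - g (Inf k)\<bar>) < e"
    using assms unfolding absolutely_continuous_on_def by meson
  show thesis
  proof (rule that[OF d])
    fix p T assume p: "p tagged_partial_division_of T" "T \<subseteq> S" and less: "(\<Sum>(x,k)\<in>p. Sup k - Inf k) < d"
    have p': "p tagged_division_of \<Union>(snd ` p)"
      using p(1) tagged_partial_division_of_Union_self by blast
    have div: "(snd ` p) division_of \<Union>(snd ` p)"
      using p(1) partial_division_of_tagged_division by blast
    have sub: "\<Union>(snd ` p) \<subseteq> S"
      using p tagged_partial_division_ofD(3)[OF p(1)] by fastforce
    have *: "(\<Sum>(x,k)\<in>p. h (Sup k) (Inf k)) = (\<Sum>k\<in>snd ` p. h (Sup k) (Inf k))"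
      if "\<And>y. h y y = 0" for h :: "real \<Rightarrow> real \<Rightarrow> real"
    proof -
      (* a division has no empty members, but the reindexing lemma asks about empty boxes too *)
      define H where "H = (\<lambda>k. if k = {} then 0 else h (Sup k) (Inf k))"
      have ne: "k \<noteq> {}" if "(x,k) \<in> p" for x k
        using tagged_partial_division_ofD(2)[OF p(1) that] by auto
      have "(\<Sum>(x,k)\<in>p. h (Sup k) (Inf k)) = (\<Sum>(x,k)\<in>p. H k)"
        by (rule sum.cong) (use ne in \<open>auto simp: H_def\<close>)
      also have "\<dots> = (\<Sum>k\<in>snd ` p. H k)"
      proof (rule sum.over_tagged_division_lemma[OF p'])
        fix u v :: real assume "box u v = {}"
        then have "u \<ge> v" by simp
        then show "H (cbox u v) = 0"
          using \<open>\<And>y. h y y = 0\<close> by (cases "u = v") (auto simp: H_def)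
      qed
      also have "\<dots> = (\<Sum>k\<in>snd ` p. h (Sup k) (Inf k))"
        by (rule sum.cong) (use ne in \<open>auto simp: H_def\<close>)
      finally show ?thesis .
    qed
    have "(\<Sum>k\<in>snd ` p. Sup k - Inf k) < d"
      using less *[of "\<lambda>a b. a - b"] by simp
    then have "(\<Sum>k\<in>snd ` p. \<bar>g (Sup k) - g (Inf k)\<bar>) < e"
      by (rule dd[OF div sub])
    then show "(\<Sum>(x,k)\<in>p. \<bar>g (Sup k) - g (Inf k)\<bar>) < e"
      using *[of "\<lambda>a b. \<bar>g a - g b\<bar>"] by simp
  qed
qed

lemma absolutely_continuous_on_subset:
  "absolutely_continuous_on S g \<Longrightarrow> T \<subseteq> S \<Longrightarrow> absolutely_continuous_on T g"
  unfolding absolutely_continuous_on_def by (meson order_trans)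

text \<open>Let \<open>N\<close> be the null set where the derivative fails and put the
  integrand to \<open>0\<close> on it. Intervals tagged outside \<open>N\<close> are handled by the straddle estimate. Intervals tagged in
  \<open>N\<close> are forced by the gauge into an open set \<open>G \<supseteq> N\<close> of measure less than \<open>\<delta>\<close>, so absolute
  continuity makes the total increment of \<open>g\<close> over them small.\<close>

lemma absolutely_continuous_on_has_integral:
  fixes g h :: "real \<Rightarrow> real"
  assumes ac: "absolutely_continuous_on {a..b} g"
    and ae: "AE x in lebesgue_on {a<..<b}. (g has_real_derivative h x) (at x)"
    and ab: "a \<le> b"
  shows "(h has_integral (g b - g a)) {a..b}"
proof -
  define N where "N = {a, b} \<union> {x\<in>{a<..<b}. \<not> (g has_real_derivative h x) (at x)}"
  have "AE x in lebesgue. x \<in> {a<..<b} \<longrightarrow> (g has_real_derivative h x) (at x)"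
    using ae by (subst (asm) AE_restrict_space_iff) auto
  then obtain N' where N': "N' \<in> null_sets lebesgue"
    "{x\<in>space lebesgue. \<not> (x \<in> {a<..<b} \<longrightarrow> (g has_real_derivative h x) (at x))} \<subseteq> N'"
    unfolding eventually_ae_filter by blast
  then have "{x\<in>{a<..<b}. \<not> (g has_real_derivative h x) (at x)} \<subseteq> N'"
    by auto
  then have "negligible {x\<in>{a<..<b}. \<not> (g has_real_derivative h x) (at x)}"
    using N'(1) negligible_iff_null_sets negligible_subset by blast
  then have negN: "negligible N"
    unfolding N_def by (simp add: negligible_Un)
  have deriv: "(g has_real_derivative h x) (at x)" if "x \<in> {a..b} - N" for x
    using that by (auto simp: N_def)
  define h0 where "h0 = (\<lambda>x. if x \<in> N then 0 else h x)"
  have "(h0 has_integral (g b - g a)) {a..b}"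
    unfolding has_integral_real
  proof (intro allI impI)
    fix e :: real assume e: "e > 0"
    define e' where "e' = e / (2 * (b - a + 1))"
    have e': "e' > 0" "e' * (b - a) < e / 2"
      using e ab by (auto simp: e'_def field_simps)
    obtain \<delta> where \<delta>: "\<delta> > 0" and small: 
    "\<And>p T. \<lbrakk>p tagged_partial_division_of T; T \<subseteq> {a..b}; (\<Sum>(x,k)\<in>p. Sup k - Inf k) < \<delta>\<rbrakk>
        \<Longrightarrow> (\<Sum>(x,k)\<in>p. \<bar>g (Sup k) - g (Inf k)\<bar>) < e / 2"
      by (rule absolutely_continuous_on_tagged[OF ac, of "e/2"]) (use e in auto)
    have "N \<in> sets lebesgue" using negN by (simp add: negligible_iff_null_sets null_setsD2)
    then obtain G where G: "open G" "N \<subseteq> G" "(G - N) \<in> lmeasurable" "emeasure lebesgue (G - N) < ennreal \<delta>"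
      using sets_lebesgue_outer_open \<delta> by metis
    have "G = (G - N) \<union> N" using G(2) by auto
    then have emG: "emeasure lebesgue G = emeasure lebesgue (G - N)"
      using negN emeasure_Un_null_set[of "G - N" lebesgue N] G(3)
      by (auto simp: negligible_iff_null_sets fmeasurable_def)
    have Glm: "G \<in> lmeasurable"
      using emG G(1,3,4) by (auto simp: fmeasurable_def)
    have mG: "measure lebesgue G < \<delta>"
      using emG G(4) \<delta> Glm by (metis emeasure_eq_measure2 ennreal_less_iff measure_nonneg)
    have "\<exists>d. x \<in> {a..b} - N \<longrightarrow> d > 0 \<and> (\<forall>p q. p \<le> x \<longrightarrow> x \<le> q \<longrightarrow> x - p < d \<longrightarrow> q - x < d \<longrightarrow> 
        \<bar>g q - g p - h x * (q - p)\<bar> \<le> e' * (q - p))" for x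
    proof (cases "x \<in> {a..b} - N")
      case True
      show ?thesis
        by (rule real_derivative_straddle[OF deriv[OF True] e'(1)]) blast
    qed auto
    then obtain d where d: "\<And>x. x \<in> {a..b} - N \<Longrightarrow> d x > 0"
       "\<And>x p q. \<lbrakk>x \<in> {a..b} - N; p \<le> x; x \<le> q; x - p < d x; q - x < d x\<rbrakk> \<Longrightarrow> 
        \<bar>g q - g p - h x * (q - p)\<bar> \<le> e' * (q - p)"
      by metis
    (* tags in N see only G; all other tags see only the range of the straddle estimate *)
    define \<gamma> where "\<gamma> = (\<lambda>x. if x \<in> N then G else if x \<in> {a..b} then ball x (d x) else ball x 1)"
    have "gauge \<gamma>"
      unfolding gauge_def \<gamma>_def using G d(1) by auto
    moreover have "norm ((\<Sum>(x,k)\<in>D. measure lborel k *\<^sub>R h0 x) - (g b - g a)) < e"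
      if D: "D tagged_division_of {a..b}" "\<gamma> fine D" for D
    proof -
      define D1 where "D1 = {(x,k)\<in>D. x \<in> N}"
      define D2 where "D2 = {(x,k)\<in>D. x \<notin> N}"
      have finD: "finite D" using D(1) by blast
      have DD: "D = D1 \<union> D2" "D1 \<inter> D2 = {}" "finite D1" "finite D2"
        using finite_subset[of D1 D] finite_subset[of D2 D] finD
        by (auto simp: D1_def D2_def)
      have kint: "\<exists>p q. k = {p..q} \<and> a \<le> p \<and> p \<le> x \<and> x \<le> q \<and> q \<le> b" if xk: "(x,k) \<in> D" for x k
      proof -
        obtain p q where "k = cbox p q" using tagged_division_ofD(4)[OF D(1) xk] by blast
        moreover have "x \<in> k" "k \<subseteq> {a..b}" using tagged_division_ofD(2,3)[OF D(1) xk] by auto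
        ultimately show ?thesis by auto
      qed
      define E where "E = (\<lambda>(x,k). measure lborel k *\<^sub>R h0 x - (g (Sup k) - g (Inf k)))"
      have "(\<Sum>(x,k)\<in>D. measure lborel k *\<^sub>R h0 x) - (g b - g a) = sum E D"
        using additive_tagged_division_1[OF ab D(1), of g]
        by (simp add: E_def sum_subtractf case_prod_unfold)
      also have "\<dots> = sum E D1 + sum E D2"
        using DD by (simp add: sum.union_disjoint)
      finally have eq: "(\<Sum>(x,k)\<in>D. measure lborel k *\<^sub>R h0 x) - (g b - g a) = sum E D1 + sum E D2" .
      have "\<bar>sum E D2\<bar> \<le> (\<Sum>(x,k)\<in>D2. e' * (Sup k - Inf k))"
      proof (rule order_trans[OF sum_abs], rule sum_mono, clarsimp)
        fix x k assume xk: "(x,k) \<in> D2"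
        then have "(x,k) \<in> D" "x \<notin> N" by (auto simp: D2_def)
        then obtain p q where pq: "k = {p..q}" "a \<le> p" "p \<le> x" "x \<le> q" "q \<le> b"
          using kint by blast
        have "k \<subseteq> ball x (d x)"
          using D(2) \<open>(x,k) \<in> D\<close> \<open>x \<notin> N\<close> pq unfolding fine_def \<gamma>_def by fastforce
        moreover have "p \<in> k" "q \<in> k" using pq by auto
        ultimately have "p \<in> ball x (d x)" "q \<in> ball x (d x)" by blast+
        then have "x - p < d x" "q - x < d x" by (auto simp: dist_real_def)
        then have "\<bar>g q - g p - h x * (q - p)\<bar> \<le> e' * (q - p)"
          using d(2)[of x p q] pq \<open>x \<notin> N\<close> by auto
        then show "\<bar>E (x,k)\<bar> \<le> e' * (Sup k - Inf k)"
          using pq \<open>x \<notin> N\<close> by (simp add: E_def h0_def abs_minus_commute mult.commute)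
      qed
      also have "\<dots> \<le> (\<Sum>(x,k)\<in>D. e' * (Sup k - Inf k))"
      proof (rule sum_mono2)
        fix z assume "z \<in> D - D2"
        then obtain x k where "z = (x,k)" "(x,k) \<in> D" by (cases z) auto
        with kint[of x k] show "0 \<le> (case z of (x, k) \<Rightarrow> e' * (Sup k - Inf k))"
          using e'(1) by auto
      qed (use DD finD in auto)
      also have "\<dots> = e' * (b - a)"
        using additive_tagged_division_1[OF ab D(1), of "\<lambda>x. x"]
        by (simp add: case_prod_unfold flip: sum_distrib_left)
      finally have 2: "\<bar>sum E D2\<bar> < e / 2" using e' by linarith
      have D1p: "D1 tagged_partial_division_of {a..b}"
        using D(1) tagged_partial_division_subset[of D "{a..b}" D1] DD(1)
        unfolding tagged_division_of_def by blast
      have "(\<Sum>(x,k)\<in>D1. Sup k - Inf k) = (\<Sum>(x,k)\<in>D1. measure lborel k)"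
      proof (rule sum.cong, simp, clarsimp)
        fix x k assume "(x,k) \<in> D1"
        then have "(x,k) \<in> D" by (auto simp: D1_def)
        with kint[of x k] show "Sup k - Inf k = measure lborel k" by auto
      qed
      also have "\<dots> = sum (measure lborel) (snd ` D1)"
        by (rule sum.over_tagged_division_lemma[OF tagged_partial_division_of_Union_self[OF D1p]])
          (auto)
      also have "\<dots> = (\<Sum>k\<in>snd ` D1. measure lebesgue k)"
      proof (rule sum.cong[OF refl])
        fix k assume "k \<in> snd ` D1"
        then obtain x where "(x,k) \<in> D" by (auto simp: D1_def)
        with kint[of x k] show "measure lborel k = measure lebesgue k" by auto
      qed
      also have "\<dots> = measure lebesgue (\<Union>(snd ` D1))"
        by (rule content_division[OF partial_division_of_tagged_division[OF D1p]])
      also have "\<dots> \<le> measure lebesgue G"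
      proof (rule measure_mono_fmeasurable[OF _ _ Glm])
        show "\<Union>(snd ` D1) \<subseteq> G"
        proof clarsimp
          fix x k y assume "(x,k) \<in> D1" "y \<in> k"
          then have "k \<subseteq> \<gamma> x" "x \<in> N" using D(2) unfolding fine_def D1_def by auto
          then show "y \<in> G" using \<open>y \<in> k\<close> by (auto simp: \<gamma>_def)
        qed
        show "\<Union>(snd ` D1) \<in> sets lebesgue"
          using lmeasurable_division[OF partial_division_of_tagged_division[OF D1p]] by blast
      qed
      also have "\<dots> < \<delta>" by (rule mG)
      finally have "(\<Sum>(x,k)\<in>D1. \<bar>g (Sup k) - g (Inf k)\<bar>) < e / 2"
        using small[OF D1p] by simp
      moreover have "\<bar>sum E D1\<bar> \<le> (\<Sum>(x,k)\<in>D1. \<bar>g (Sup k) - g (Inf k)\<bar>)"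
      proof (rule order_trans[OF sum_abs], rule sum_mono, clarsimp)
        fix x k assume xk: "(x,k) \<in> D1"
        then show "\<bar>E (x,k)\<bar> \<le> \<bar>g (Sup k) - g (Inf k)\<bar>"
          by (simp add: E_def h0_def D1_def)
      qed
      ultimately show ?thesis unfolding eq using 2 by simp
    qed
    ultimately show "\<exists>\<gamma>. gauge \<gamma> \<and> (\<forall>D. D tagged_division_of {a..b} \<and> \<gamma> fine D \<longrightarrow>
        norm ((\<Sum>(x,k)\<in>D. measure lborel k *\<^sub>R h0 x) - (g b - g a)) < e)"
      by (intro exI[of _ \<gamma>] conjI allI impI) simp_all
  qed
  then show ?thesis
    by (rule has_integral_spike[OF negN, rotated]) (auto simp: h0_def)
qed

section \<open>The symmetric decreasing rearrangement\<close>

definition superlevel_measure :: "real set \<Rightarrow> (real \<Rightarrow> real) \<Rightarrow> real \<Rightarrow> real" where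
  "superlevel_measure X f s = measure lebesgue {x\<in>X. s < f x}"

lemma superlevel_sets:
  fixes f :: "real \<Rightarrow> real"
  assumes "X \<in> sets lebesgue" "f \<in> borel_measurable (lebesgue_on X)"
  shows "{x\<in>X. s < f x} \<in> sets lebesgue"
proof -
  have "{x\<in>space (lebesgue_on X). s < f x} \<in> sets (lebesgue_on X)"
    using assms(2) by measurable
  then show ?thesis
    using assms(1) by (simp add: sets_restrict_space_iff)
qed

lemma superlevel_lmeasurable:
  fixes f :: "real \<Rightarrow> real"
  assumes "X \<in> lmeasurable" "f \<in> borel_measurable (lebesgue_on X)"
  shows "{x\<in>X. s < f x} \<in> lmeasurable"
  by (rule fmeasurableI2[OF assms(1) _ superlevel_sets[OF fmeasurableD[OF assms(1)] assms(2)]]) auto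

lemma superlevel_measure_antimono:
  assumes "X \<in> lmeasurable" "f \<in> borel_measurable (lebesgue_on X)" "s \<le> t"
  shows "superlevel_measure X f t \<le> superlevel_measure X f s"
  unfolding superlevel_measure_def
  by (rule measure_mono_fmeasurable)
    (use assms in \<open>auto intro: superlevel_lmeasurable superlevel_sets\<close>)

text \<open>Right continuity of the distribution function, by continuity from below of the
  measure along \<open>{f > s + 1/n} \<up> {f > s}\<close>.\<close>

lemma superlevel_measure_right_lower:
  assumes X: "X \<in> lmeasurable" "f \<in> borel_measurable (lebesgue_on X)"
    and t: "t < superlevel_measure X f s"
  obtains s' where "s < s'" "t < superlevel_measure X f s'"
proof -
  define A where "A = (\<lambda>n. {x\<in>X. s + 1 / real (Suc n) < f x})"
  have UA: "(\<Union>n. A n) = {x\<in>X. s < f x}"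
  proof (intro equalityI subsetI)
    fix x assume "x \<in> (\<Union>n. A n)"
    then obtain n where "x \<in> X" "s + 1 / real (Suc n) < f x" by (auto simp: A_def)
    moreover from this(2) have "s < f x" by (rule le_less_trans[rotated]) simp
    ultimately show "x \<in> {x\<in>X. s < f x}" by simp
  next
    fix x assume x: "x \<in> {x\<in>X. s < f x}"
    then obtain n where "inverse (real (Suc n)) < f x - s"
      using reals_Archimedean[of "f x - s"] by auto
    then show "x \<in> (\<Union>n. A n)" using x by (auto simp: A_def inverse_eq_divide intro!: exI[of _ n])
  qed
  have "(\<lambda>n. measure lebesgue (A n)) \<longlonglongrightarrow> measure lebesgue (\<Union>n. A n)"
  proof (rule Lim_measure_incseq)
    show "range A \<subseteq> sets lebesgue"
      using X superlevel_sets by (auto simp: A_def)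
    show "incseq A"
    proof (rule monoI, rule subsetI)
      fix m n :: nat and x assume "m \<le> n" "x \<in> A m"
      moreover have "s + 1 / real (Suc n) \<le> s + 1 / real (Suc m)" using \<open>m \<le> n\<close> by (simp add: frac_le)
      ultimately show "x \<in> A n" unfolding A_def by (auto intro: le_less_trans)
    qed
    show "emeasure lebesgue (\<Union>n. A n) \<noteq> \<infinity>"
      unfolding UA using superlevel_lmeasurable[OF X, of s] by (auto simp: fmeasurable_def)
  qed
  then have "(\<lambda>n. measure lebesgue (A n)) \<longlonglongrightarrow> superlevel_measure X f s"
    unfolding UA superlevel_measure_def .
  then have "eventually (\<lambda>n. t < measure lebesgue (A n)) sequentially"
    using t by (rule order_tendstoD)
  then obtain n where "t < measure lebesgue (A n)"
    using eventually_happens' sequentially_bot by blast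
  then show thesis
    by (intro that[of "s + 1 / real (Suc n)"]) (auto simp: A_def superlevel_measure_def)
qed

lemma superlevel_measure_vanishes:
  assumes X: "X \<in> lmeasurable" "f \<in> borel_measurable (lebesgue_on X)" and t: "0 < t"
  obtains s where "superlevel_measure X f s < t"
proof -
  define A where "A = (\<lambda>n. {x\<in>X. real n < f x})"
  have IA: "(\<Inter>n. A n) = {}"
  proof (intro equals0I)
    fix x assume x: "x \<in> (\<Inter>n. A n)"
    obtain n where "f x < real n" using reals_Archimedean2 by blast
    moreover have "x \<in> A n" using x by blast
    ultimately show False by (simp add: A_def)
  qed
  have "(\<lambda>n. measure lebesgue (A n)) \<longlonglongrightarrow> measure lebesgue (\<Inter>n. A n)"
  proof (rule Lim_measure_decseq)
    show "range A \<subseteq> sets lebesgue"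
      using X superlevel_sets by (auto simp: A_def)
    show "decseq A" by (rule antimonoI) (auto simp: A_def)
    show "emeasure lebesgue (A n) \<noteq> \<infinity>" for n
      unfolding A_def using superlevel_lmeasurable[OF X, of n] by (auto simp: fmeasurable_def)
  qed
  then have "(\<lambda>n. measure lebesgue (A n)) \<longlonglongrightarrow> 0"
    unfolding IA by simp
  then have "eventually (\<lambda>n. measure lebesgue (A n) < t) sequentially"
    using t by (rule order_tendstoD)
  then obtain n where "measure lebesgue (A n) < t"
    using eventually_happens' sequentially_bot by blast
  then show thesis
    by (intro that[of "real n"]) (auto simp: A_def superlevel_measure_def)
qed

lemma superlevel_measure_negative:
  assumes X: "X \<in> sets lebesgue" and f: "AE x in lebesgue_on X. 0 \<le> f x" "f \<in> borel_measurable (lebesgue_on X)"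
    and s: "s < 0"
  shows "superlevel_measure X f s = measure lebesgue X"
  unfolding superlevel_measure_def
proof (rule measure_eq_AE)
  show "AE x in lebesgue. x \<in> {x\<in>X. s < f x} \<longleftrightarrow> x \<in> X"
  proof -
    have "AE x in lebesgue. x \<in> X \<longrightarrow> 0 \<le> f x"
      using f(1) X by (simp add: AE_restrict_space_iff)
    then show ?thesis by eventually_elim (use s in auto)
  qed
qed (use superlevel_sets[OF X f(2)] X in auto)

text \<open>The Galois connection between the distribution function and its generalised inverse \<open>f\<^sup>*\<close>. Strictness on
  both sides is where right continuity enters.\<close>

lemma less_decreasing_rearrangement_iff:
  assumes X: "X \<in> lmeasurable" "f \<in> borel_measurable (lebesgue_on X)"
    and t: "0 < t" "t < measure lebesgue X"
  shows "ereal s < decreasing_rearrangement X f t \<longleftrightarrow> t < superlevel_measure X f s"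
proof -
  have eq: "decreasing_rearrangement X f t = Inf {ereal s | s. superlevel_measure X f s \<le> t}"
    using t by (auto simp: decreasing_rearrangement_def superlevel_measure_def)
  show ?thesis
  proof
    assume less: "ereal s < decreasing_rearrangement X f t"
    show "t < superlevel_measure X f s"
    proof (rule ccontr)
      assume "\<not> t < superlevel_measure X f s"
      then have "decreasing_rearrangement X f t \<le> ereal s"
        unfolding eq by (intro Inf_lower) auto
      with less show False by simp
    qed
  next
    assume "t < superlevel_measure X f s"
    then obtain s' where s': "s < s'" "t < superlevel_measure X f s'"
      using superlevel_measure_right_lower[OF X] by blast
    have "ereal s' \<le> decreasing_rearrangement X f t"
      unfolding eq
    proof (rule Inf_greatest, clarsimp)
      fix r assume "superlevel_measure X f r \<le> t"
      with s'(2) superlevel_measure_antimono[OF X, of r s'] show "s' \<le> r" by linarith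
    qed
    then show "ereal s < decreasing_rearrangement X f t"
      using s'(1) by (meson ereal_less(1) less_ereal.simps(1) less_le_trans)
  qed
qed

text \<open>For \<open>f \<ge> 0\<close> the value \<open>f\<^sup>*(t)\<close> is finite in the interior: the distribution function drops below
  \<open>t\<close> at high levels, and equals \<open>|X| > t\<close> at negative levels.\<close>

lemma decreasing_rearrangement_real:
  assumes X: "X \<in> lmeasurable" "f \<in> borel_measurable (lebesgue_on X)"
    and f: "AE x in lebesgue_on X. 0 \<le> f x"
    and t: "0 < t" "t < measure lebesgue X"
  shows "ereal (real_of_ereal (decreasing_rearrangement X f t)) = decreasing_rearrangement X f t"
    and "0 \<le> real_of_ereal (decreasing_rearrangement X f t)"
proof -
  let ?d = "decreasing_rearrangement X f t"
  have X': "X \<in> sets lebesgue" using X(1) by auto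
  obtain s where "superlevel_measure X f s < t"
    using superlevel_measure_vanishes[OF X t(1)] by blast
  then have up: "?d \<le> ereal s"
    using less_decreasing_rearrangement_iff[OF X t, of s] by auto
  have low: "ereal r < ?d" if "r < 0" for r
    using less_decreasing_rearrangement_iff[OF X t, of r] superlevel_measure_negative[OF X' f X(2) that] t by auto
  from up low[of "-1"] have "\<bar>?d\<bar> \<noteq> \<infinity>" by auto
  then show *: "ereal (real_of_ereal ?d) = ?d" by (rule ereal_real')
  show "0 \<le> real_of_ereal ?d"
  proof (rule ccontr)
    assume "\<not> 0 \<le> real_of_ereal ?d"
    then have "ereal (real_of_ereal ?d) < ?d" by (intro low) simp
    with * show False by simp
  qed
qed

lemma symmetric_rearrangement_real:
  fixes X :: "real set" and f :: "real \<Rightarrow> real"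
  defines "g \<equiv> \<lambda>x. real_of_ereal (symmetric_decreasing_rearrangement X f x)"
    and "L \<equiv> measure lebesgue X / 2"
  assumes X: "X \<in> lmeasurable" "f \<in> borel_measurable (lebesgue_on X)"
    and f: "AE x in lebesgue_on X. 0 \<le> f x"
    and x: "0 < \<bar>x\<bar>" "\<bar>x\<bar> < L"
  shows "symmetric_decreasing_rearrangement X f x = ereal (g x)"
    and "0 \<le> g x"
    and "s < g x \<longleftrightarrow> 2 * \<bar>x\<bar> < superlevel_measure X f s"
proof -
  have t: "0 < 2 * \<bar>x\<bar>" "2 * \<bar>x\<bar> < measure lebesgue X" using x by (auto simp: L_def)
  note d = decreasing_rearrangement_real[OF X f t]
  show "symmetric_decreasing_rearrangement X f x = ereal (g x)" "0 \<le> g x"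
    using d by (simp_all add: g_def symmetric_decreasing_rearrangement_def)
  have "s < g x \<longleftrightarrow> ereal s < decreasing_rearrangement X f (2 * \<bar>x\<bar>)"
    by (subst d(1)[symmetric]) (simp add: g_def symmetric_decreasing_rearrangement_def)
  then show "s < g x \<longleftrightarrow> 2 * \<bar>x\<bar> < superlevel_measure X f s"
    using less_decreasing_rearrangement_iff[OF X t] by simp
qed

text \<open>By the Galois connection \<open>{f\<^sup># > s}\<close> is, up to the three exceptional points \<open>0, L, -L\<close>, the
  centred interval of length \<open>|{f > s}|\<close>. Agreement of all superlevel measures determines the distribution.\<close>

lemma symmetric_rearrangement_equimeasurable:
  fixes X :: "real set" and f :: "real \<Rightarrow> real"
  defines "g \<equiv> \<lambda>x. real_of_ereal (symmetric_decreasing_rearrangement X f x)"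
    and "L \<equiv> measure lebesgue X / 2"
  assumes X: "X \<in> lmeasurable" "f \<in> borel_measurable (lebesgue_on X)"
    and f: "AE x in lebesgue_on X. 0 \<le> f x"
  shows "g \<in> borel_measurable (lebesgue_on {-L..L})"
    and "distr (lebesgue_on {-L..L}) borel g = distr (lebesgue_on X) borel f"
proof -
  define F where "F = {0, L, -L}"
  have finF: "finite F" by (simp add: F_def)
  have X': "X \<in> sets lebesgue" using X(1) by auto
  define I where "I = (\<lambda>s. {- (superlevel_measure X f s / 2)<..<superlevel_measure X f s / 2})"
  have sl: "0 \<le> superlevel_measure X f s" "superlevel_measure X f s / 2 \<le> L" for s
  proof -
    show "0 \<le> superlevel_measure X f s" by (simp add: superlevel_measure_def)
    have "superlevel_measure X f s \<le> measure lebesgue X"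
      unfolding superlevel_measure_def
      by (rule measure_mono_fmeasurable) (use superlevel_sets[OF X' X(2)] X in auto)
    then show "superlevel_measure X f s / 2 \<le> L" by (simp add: L_def)
  qed
  have mem: "x \<in> {x\<in>{-L..L}. s < g x} \<longleftrightarrow> x \<in> I s" if "x \<notin> F" for x s
  proof (cases "\<bar>x\<bar> < L")
    case True
    then have "s < g x \<longleftrightarrow> 2 * \<bar>x\<bar> < superlevel_measure X f s"
      using symmetric_rearrangement_real(3)[OF X f, of x s] that unfolding g_def L_def F_def by auto
    then show ?thesis using True by (auto simp: I_def)
  next
    case False
    then have "x \<notin> {-L..L}" using that by (auto simp: F_def)
    moreover have "x \<notin> I s" using False sl[of s] by (auto simp: I_def)
    ultimately show ?thesis by blast
  qed
  have level: "{x\<in>{-L..L}. s < g x} \<in> sets lebesgue" for s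
  proof -
    have eq: "{x\<in>{-L..L}. s < g x} = (I s - F) \<union> ({x\<in>{-L..L}. s < g x} \<inter> F)"
      using mem by blast
    have "{x\<in>{-L..L}. s < g x} \<inter> F \<in> sets lebesgue"
      using finF by (intro negligible_imp_sets negligible_finite) auto
    moreover have "I s - F \<in> sets lebesgue"
      using negligible_imp_sets[OF negligible_finite[OF finF]] by (simp add: I_def sets.Diff)
    ultimately show ?thesis by (subst eq) (rule sets.Un)
  qed
  show meas: "g \<in> borel_measurable (lebesgue_on {-L..L})"
    unfolding borel_measurable_iff_greater space_lebesgue_on
  proof
    show "{x\<in>{-L..L}. s < g x} \<in> sets (lebesgue_on {-L..L})" for s
      by (subst sets_restrict_space_iff) (simp, rule conjI[OF _ level], blast)
  qed
  have em: "emeasure lebesgue {x\<in>{-L..L}. s < g x} = superlevel_measure X f s" for s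
  proof -
    have "AE x in lebesgue. x \<notin> F"
      using finF by (intro AE_not_in) (simp add: negligible_finite flip: negligible_iff_null_sets)
    then have "AE x in lebesgue. x \<in> {x\<in>{-L..L}. s < g x} \<longleftrightarrow> x \<in> I s"
      by eventually_elim (rule mem)
    then have "emeasure lebesgue {x\<in>{-L..L}. s < g x} = emeasure lebesgue (I s)"
      by (rule emeasure_eq_AE) (use level in \<open>auto simp: I_def\<close>)
    also have "\<dots> = superlevel_measure X f s"
      using sl(1)[of s] by (simp add: I_def)
    finally show ?thesis .
  qed
  show "distr (lebesgue_on {-L..L}) borel g = distr (lebesgue_on X) borel f"
  proof (rule measure_eqI_lessThan)
    have g1: "emeasure (distr (lebesgue_on {-L..L}) borel g) {s<..} = superlevel_measure X f s" for s
    proof -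
      have "emeasure (distr (lebesgue_on {-L..L}) borel g) {s<..} 
          = emeasure (lebesgue_on {-L..L}) {x\<in>{-L..L}. s < g x}"
        by (subst emeasure_distr[OF meas]) (auto intro!: arg_cong[where f = "emeasure _"])
      also have "\<dots> = emeasure lebesgue {x\<in>{-L..L}. s < g x}"
        by (rule emeasure_restrict_space) auto
      finally show ?thesis by (simp only: em)
    qed
    have f1: "emeasure (distr (lebesgue_on X) borel f) {s<..} = superlevel_measure X f s" for s
    proof -
      have "emeasure (distr (lebesgue_on X) borel f) {s<..} 
          = emeasure (lebesgue_on X) {x\<in>X. s < f x}"
        by (subst emeasure_distr[OF X(2)]) (auto intro!: arg_cong[where f = "emeasure _"])
      also have "\<dots> = emeasure lebesgue {x\<in>X. s < f x}"
        by (rule emeasure_restrict_space) (use X' in auto)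
      also have "\<dots> = superlevel_measure X f s"
        unfolding superlevel_measure_def by (rule emeasure_eq_measure2[OF superlevel_lmeasurable[OF X]])
      finally show ?thesis .
    qed
    show "emeasure (distr (lebesgue_on {-L..L}) borel g) {s<..} < \<infinity>" for s
      unfolding g1 by simp
    show "emeasure (distr (lebesgue_on {-L..L}) borel g) {s<..} = emeasure (distr (lebesgue_on X) borel f) {s<..}" for s
      unfolding g1 f1 ..
  qed auto
qed

lemma integral_distr_eq:
  fixes f g :: "real \<Rightarrow> real" and h :: "real \<Rightarrow> real"
  assumes eq: "distr M borel f = distr N borel g"
    and meas: "f \<in> borel_measurable M" "g \<in> borel_measurable N" "h \<in> borel_measurable borel"
  shows "integrable M (\<lambda>x. h (f x)) \<longleftrightarrow> integrable N (\<lambda>x. h (g x))"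
    and "integral\<^sup>L M (\<lambda>x. h (f x)) = integral\<^sup>L N (\<lambda>x. h (g x))"
  using eq integrable_distr_eq[OF meas(1) meas(3)] integrable_distr_eq[OF meas(2) meas(3)]
    integral_distr[OF meas(1) meas(3)] integral_distr[OF meas(2) meas(3)] by auto

lemma symmetric_rearrangement_integrable:
  fixes X :: "real set" and f :: "real \<Rightarrow> real"
  defines "g \<equiv> \<lambda>x. real_of_ereal (symmetric_decreasing_rearrangement X f x)"
    and "L \<equiv> measure lebesgue X / 2"
  assumes X: "X \<in> lmeasurable" and int: "integrable (lebesgue_on X) f"
    and f: "AE x in lebesgue_on X. 0 \<le> f x"
  shows "integrable (lebesgue_on {-L..L}) g"
    and "integral\<^sup>L (lebesgue_on {-L..L}) g = integral\<^sup>L (lebesgue_on X) f"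
proof -
  have fm: "f \<in> borel_measurable (lebesgue_on X)" using int by simp
  note em = symmetric_rearrangement_equimeasurable[OF X fm f, folded g_def L_def]
  note * = integral_distr_eq[OF em(2) em(1) fm, of "\<lambda>x. x"]
  show "integrable (lebesgue_on {-L..L}) g" 
    "integral\<^sup>L (lebesgue_on {-L..L}) g = integral\<^sup>L (lebesgue_on X) f"
    using * int by auto
qed

text \<open>The bathtub principle. With the threshold \<open>c = f\<^sup>#(\<rho>)\<close>, the bound \<open>f \<le> c + (f - c)\<^sup>+\<close> on \<open>A\<close> gives
  \<open>\<integral>\<^sub>A f \<le> 2 \<rho> c + \<integral> (f - c)\<^sup>+\<close>. The last integral does not change under rearrangement, and \<open>f\<^sup># \<ge> c\<close>
  exactly inside \<open>[-\<rho>, \<rho>]\<close> up to ties, so for \<open>f\<^sup>#\<close> the bound is an equality.\<close>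

lemma integral_le_symmetric_rearrangement:
  fixes X :: "real set" and f :: "real \<Rightarrow> real"
  defines "g \<equiv> \<lambda>x. real_of_ereal (symmetric_decreasing_rearrangement X f x)"
    and "L \<equiv> measure lebesgue X / 2"
  assumes X: "X \<in> lmeasurable" and int: "integrable (lebesgue_on X) f"
    and f: "AE x in lebesgue_on X. 0 \<le> f x"
    and A: "A \<in> sets lebesgue" "A \<subseteq> X" and \<rho>: "measure lebesgue A = 2 * \<rho>" "0 < \<rho>" "\<rho> < L"
  shows "integral\<^sup>L (lebesgue_on X) (\<lambda>x. indicator A x * f x) 
       \<le> integral\<^sup>L (lebesgue_on {-L..L}) (\<lambda>x. indicator {-\<rho>..\<rho>} x * g x)"
proof -
  have X': "X \<in> sets lebesgue" using X by auto
  have fm: "f \<in> borel_measurable (lebesgue_on X)" using int by simp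
  note em = symmetric_rearrangement_equimeasurable[OF X fm f, folded g_def L_def]
  note g_int = symmetric_rearrangement_integrable[OF X int f, folded g_def L_def]
  have g_iff: "s < g x \<longleftrightarrow> 2 * \<bar>x\<bar> < superlevel_measure X f s" if "0 < \<bar>x\<bar>" "\<bar>x\<bar> < L" for x s
    using symmetric_rearrangement_real(3)[OF X fm f] that unfolding g_def L_def .
  let ?M = "lebesgue_on X" and ?N = "lebesgue_on {-L..L}"
  have A_lm: "A \<in> lmeasurable" using fmeasurableI2[OF X A(2,1)] .
  have A_M: "A \<in> sets ?M" using A X' by (simp add: sets_restrict_space_iff)
  have finM: "finite_measure ?M" and finN: "finite_measure ?N"
    using X by (auto intro!: finite_measure_lebesgue_on)
  have mA: "measure ?M A = 2 * \<rho>"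
    using A \<rho>(1) X' by (simp add: measure_restrict_space)
  have J_N: "{-\<rho>..\<rho>} \<in> sets ?N" "measure ?N {-\<rho>..\<rho>} = 2 * \<rho>"
    using \<rho> by (auto simp: sets_restrict_space_iff measure_restrict_space)
  define c where "c = g \<rho>"
  define h where "h = (\<lambda>y::real. max (y - c) 0)"
  have hm: "h \<in> borel_measurable borel" unfolding h_def by measurable
  have int_h: "integrable ?M (\<lambda>x. h (f x))"
    unfolding h_def by (intro integrable_max Bochner_Integration.integrable_diff int) (use finM in \<open>auto simp: finite_measure.integrable_const\<close>)
  have int_hg: "integrable ?N (\<lambda>x. h (g x))" 
    and eq_h: "integral\<^sup>L ?N (\<lambda>x. h (g x)) = integral\<^sup>L ?M (\<lambda>x. h (f x))"
    using integral_distr_eq[OF em(2) em(1) fm hm] int_h by auto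
  have ind_M: "integrable ?M (\<lambda>x. indicator A x * f x)"
    using integrable_mult_indicator[OF A_M int] by simp
  have ind_N: "integrable ?N (\<lambda>x. indicator {-\<rho>..\<rho>} x * g x)"
    using integrable_mult_indicator[OF J_N(1) g_int(1)] by simp
  have indc_M: "integrable ?M (\<lambda>x. c * indicator A x)"
    using A_M finite_measure.emeasure_finite[OF finM, of A]
    by (intro integrable_mult_right integrable_real_indicator) (auto simp: top.not_eq_extremum)
  have indc_N: "integrable ?N (\<lambda>x. c * indicator {-\<rho>..\<rho>} x)"
    using J_N(1) finite_measure.emeasure_finite[OF finN, of "{-\<rho>..\<rho>}"]
    by (intro integrable_mult_right integrable_real_indicator) (auto simp: top.not_eq_extremum)
  have anti: "g y \<le> g x" if "0 < \<bar>x\<bar>" "\<bar>x\<bar> \<le> \<bar>y\<bar>" "\<bar>y\<bar> < L" for x y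
  proof (rule ccontr)
    assume "\<not> g y \<le> g x"
    then have "2 * \<bar>y\<bar> < superlevel_measure X f (g x)" using g_iff[of y "g x"] that by auto
    then have "g x < g x" using g_iff[of x "g x"] that by auto
    then show False by simp
  qed
  have "integral\<^sup>L ?M (\<lambda>x. indicator A x * f x) \<le> integral\<^sup>L ?M (\<lambda>x. c * indicator A x + h (f x))"
    by (intro integral_mono ind_M Bochner_Integration.integrable_add indc_M int_h)
      (auto simp: h_def indicator_def)
  also have "\<dots> = 2 * \<rho> * c + integral\<^sup>L ?N (\<lambda>x. h (g x))"
    using A_M A(2) mA by (subst Bochner_Integration.integral_add[OF indc_M int_h])
      (simp add: eq_h Int_absorb2)
  also have "integral\<^sup>L ?N (\<lambda>x. h (g x)) 
      = integral\<^sup>L ?N (\<lambda>x. indicator {-\<rho>..\<rho>} x * g x - c * indicator {-\<rho>..\<rho>} x)"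
  proof (rule integral_cong_AE)
    have "AE x in lebesgue. x \<notin> {0, L, -L}"
      by (intro AE_not_in) (simp add: negligible_finite flip: negligible_iff_null_sets)
    then have "AE x in ?N. x \<notin> {0, L, -L}"
      by (subst AE_restrict_space_iff) (auto elim: eventually_mono)
    moreover have "AE x in ?N. x \<in> {-L..L}"
      by (rule AE_I2) auto
    ultimately show "AE x in ?N. h (g x) = indicator {-\<rho>..\<rho>} x * g x - c * indicator {-\<rho>..\<rho>} x"
    proof eventually_elim
      case (elim x)
      then have x: "0 < \<bar>x\<bar>" "\<bar>x\<bar> < L" by auto
      show ?case
      proof (cases "\<bar>x\<bar> \<le> \<rho>")
        case True
        then have "c \<le> g x" unfolding c_def using anti[of x \<rho>] x \<rho> by auto
        then show ?thesis using True by (auto simp: h_def abs_le_iff)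
      next
        case False
        then have "g x \<le> c" unfolding c_def using anti[of \<rho> x] x \<rho> by auto
        then show ?thesis using False by (auto simp: h_def indicator_def)
      qed
    qed
  qed (use int_hg ind_N indc_N in auto)
  also have "\<dots> = integral\<^sup>L ?N (\<lambda>x. indicator {-\<rho>..\<rho>} x * g x) - 2 * \<rho> * c"
    using J_N \<rho> by (subst Bochner_Integration.integral_diff[OF ind_N indc_N])
      (simp add: Int_absorb2)
  finally show ?thesis by simp
qed

lemma integral_lebesgue_on_indicator:
  fixes f :: "real \<Rightarrow> real"
  assumes "X \<in> sets lebesgue" "A \<in> sets lebesgue" "A \<subseteq> X" "integrable (lebesgue_on X) f"
  shows "integral\<^sup>L (lebesgue_on X) (\<lambda>x. indicator A x * f x) = integral A f"
proof -
  have "integrable lebesgue (\<lambda>x. indicator X x *\<^sub>R f x)"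
    using assms(1,4) by (subst (asm) integrable_restrict_space) auto
  then have "set_integrable lebesgue X f" by (simp add: set_integrable_def)
  then have si: "set_integrable lebesgue A f"
    using assms(2,3) by (rule set_integrable_subset)
  have "integral\<^sup>L (lebesgue_on X) (\<lambda>x. indicator A x * f x)
      = integral\<^sup>L lebesgue (\<lambda>x. indicator X x *\<^sub>R (indicator A x * f x))"
    using assms(1) by (intro integral_restrict_space) auto
  also have "\<dots> = (LINT x:A|lebesgue. f x)"
    unfolding set_lebesgue_integral_def
    by (rule Bochner_Integration.integral_cong) (use assms(3) in \<open>auto simp: indicator_def\<close>)
  also have "\<dots> = integral A f" by (rule set_lebesgue_integral_eq_integral(2)[OF si])
  finally show ?thesis .
qed

text \<open>The same facts as gauge integrals on \<open>[-L, L]\<close>, the form in which they meet the drops of \<open>u'\<close> and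
  \<open>v'\<close>. The lengths \<open>0\<close> and \<open>2 L\<close>, where the bathtub threshold is not available, are treated
  separately.\<close>

lemma symmetric_rearrangement_interval:
  fixes f :: "real \<Rightarrow> real" and L :: real
  defines "g \<equiv> \<lambda>x. real_of_ereal (symmetric_decreasing_rearrangement {-L..L} f x)"
  assumes L: "0 < L" and int: "set_integrable lebesgue {-L..L} f"
    and f: "AE x in lebesgue_on {-L..L}. 0 \<le> f x"
  shows "\<And>x. \<lbrakk>0 < \<bar>x\<bar>; \<bar>x\<bar> < L\<rbrakk> \<Longrightarrow> symmetric_decreasing_rearrangement {-L..L} f x = ereal (g x) \<and> 0 \<le> g x"
    and "integral {-L..L} g = integral {-L..L} f"
    and "\<And>a b. \<lbrakk>-L \<le> a; a \<le> b; b \<le> L\<rbrakk> \<Longrightarrow> integral {a..b} f \<le> integral {-((b - a) / 2)..(b - a) / 2} g"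
proof -
  have X: "{-L..L} \<in> lmeasurable" by simp
  have mX: "measure lebesgue {-L..L} / 2 = L" using L by simp
  have int': "integrable (lebesgue_on {-L..L}) f"
    using int by (subst integrable_restrict_space) (auto simp: set_integrable_def)
  have fm: "f \<in> borel_measurable (lebesgue_on {-L..L})" using int' by simp
  show "symmetric_decreasing_rearrangement {-L..L} f x = ereal (g x) \<and> 0 \<le> g x"
    if "0 < \<bar>x\<bar>" "\<bar>x\<bar> < L" for x
    using symmetric_rearrangement_real(1,2)[OF X fm f] that unfolding mX g_def by blast
  note g = symmetric_rearrangement_integrable[OF X int' f, unfolded mX, folded g_def]
  have whole: "integral\<^sup>L (lebesgue_on {-L..L}) w = integral {-L..L} w" 
    if "integrable (lebesgue_on {-L..L}) w" for w :: "real \<Rightarrow> real"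
  proof -
    have "integral\<^sup>L (lebesgue_on {-L..L}) w = integral\<^sup>L (lebesgue_on {-L..L}) (\<lambda>x. indicator {-L..L} x * w x)"
      by (rule Bochner_Integration.integral_cong) auto
    also have "\<dots> = integral {-L..L} w"
      by (rule integral_lebesgue_on_indicator) (use that in auto)
    finally show ?thesis .
  qed
  show total: "integral {-L..L} g = integral {-L..L} f"
    using whole[OF g(1)] whole[OF int'] g(2) by simp
  show "integral {a..b} f \<le> integral {-((b - a) / 2)..(b - a) / 2} g"
    if ab: "-L \<le> a" "a \<le> b" "b \<le> L" for a b
  proof -
    define \<rho> where "\<rho> = (b - a) / 2"
    have r: "2 * \<rho> = b - a" by (simp add: \<rho>_def)
    then have "\<rho> = 0 \<or> \<rho> = L \<or> 0 < \<rho> \<and> \<rho> < L" using ab by linarith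
    then have "integral {a..b} f \<le> integral {-\<rho>..\<rho>} g"
    proof (elim disjE)
      assume "\<rho> = 0"
      then show ?thesis using r by simp
    next
      assume "\<rho> = L"
      then have "a = -L" "b = L" using r ab by linarith+
      then show ?thesis using total \<open>\<rho> = L\<close> by simp
    next
      assume \<rho>: "0 < \<rho> \<and> \<rho> < L"
      have "integral\<^sup>L (lebesgue_on {-L..L}) (\<lambda>x. indicator {a..b} x * f x) 
          \<le> integral\<^sup>L (lebesgue_on {-L..L}) (\<lambda>x. indicator {-\<rho>..\<rho>} x * g x)"
        using integral_le_symmetric_rearrangement[OF X int' f, of "{a..b}" \<rho>, unfolded mX] ab \<rho> r
        by (simp add: g_def)
      also have "integral\<^sup>L (lebesgue_on {-L..L}) (\<lambda>x. indicator {a..b} x * f x) = integral {a..b} f"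
        by (rule integral_lebesgue_on_indicator) (use ab int' in auto)
      also have "integral\<^sup>L (lebesgue_on {-L..L}) (\<lambda>x. indicator {-\<rho>..\<rho>} x * g x) = integral {-\<rho>..\<rho>} g"
        by (rule integral_lebesgue_on_indicator) (use \<rho> g(1) in auto)
      finally show ?thesis .
    qed
    then show ?thesis by (simp add: \<rho>_def)
  qed
qed

section \<open>Comparison of integrals over intervals\<close>

lemma real_continuous_antiderivative:
  fixes h :: "real \<Rightarrow> real"
  assumes "continuous_on UNIV h"
  obtains H where "\<And>x. (H has_real_derivative h x) (at x)"
proof -
  have "\<exists>F. \<forall>x :: real. -\<infinity> < ereal x \<longrightarrow> ereal x < \<infinity> \<longrightarrow> (F has_vector_derivative h x) (at x)"
    using assms by (intro einterval_antiderivative) (auto simp: continuous_on_eq_continuous_at)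
  then show thesis
    using that by (auto simp: has_real_derivative_iff_has_vector_derivative)
qed

text \<open>Two integrations by parts. The integral of \<open>w\<close> over \<open>[s - r, s + r]\<close> is expressed by the values of
  \<open>w\<close> at the far points \<open>s \<plusminus> R\<close> and by the drops \<open>e (s - \<rho>) - e (s + \<rho>)\<close> of its derivative over
  windows around \<open>s\<close>, with the nonnegative weight \<open>min \<rho> r\<close>. The functions \<open>P\<close> and \<open>Q\<close> are
  antiderivatives of the integrand on \<open>[0, r]\<close> and \<open>[r, R]\<close>.\<close>

lemma folded_integral:
  fixes w e :: "real \<Rightarrow> real"
  assumes w: "\<And>x. (w has_real_derivative e x) (at x)" and r: "0 \<le> r" "r \<le> R"
  shows "((\<lambda>\<rho>. min \<rho> r * (e (s - \<rho>) - e (s + \<rho>))) has_integral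
           (integral {s - r..s + r} w - r * (w (s + R) + w (s - R)))) {0..R}"
proof -
  have "continuous_on UNIV w"
    using w by (meson DERIV_isCont continuous_at_imp_continuous_on)
  then obtain Z where Z: "\<And>x. (Z has_real_derivative w x) (at x)"
    using real_continuous_antiderivative by blast
  have Iw: "integral {s - r..s + r} w = Z (s + r) - Z (s - r)"
    using r Z by (intro integral_unique fundamental_theorem_of_calculus)
      (auto simp flip: has_real_derivative_iff_has_vector_derivative intro: has_field_derivative_at_within)
  define P where "P = (\<lambda>\<rho>. Z (s + \<rho>) - Z (s - \<rho>) - \<rho> * (w (s + \<rho>) + w (s - \<rho>)))"
  define Q where "Q = (\<lambda>\<rho>. - r * (w (s + \<rho>) + w (s - \<rho>)))"
  have shift: "((\<lambda>\<rho>. F (s + \<rho>)) has_real_derivative G (s + \<rho>)) (at \<rho>)"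
              "((\<lambda>\<rho>. F (s - \<rho>)) has_real_derivative - G (s - \<rho>)) (at \<rho>)"
    if "\<And>x. (F has_real_derivative G x) (at x)" for F G \<rho>
  proof -
    have "((\<lambda>\<rho>. s + \<rho>) has_real_derivative 1) (at \<rho>)" "((\<lambda>\<rho>. s - \<rho>) has_real_derivative -1) (at \<rho>)"
      by (auto intro!: derivative_eq_intros)
    from DERIV_chain2[OF that this(1)] DERIV_chain2[OF that this(2)] show
      "((\<lambda>\<rho>. F (s + \<rho>)) has_real_derivative G (s + \<rho>)) (at \<rho>)"
      "((\<lambda>\<rho>. F (s - \<rho>)) has_real_derivative - G (s - \<rho>)) (at \<rho>)" by simp_all
  qed
  have P: "(P has_real_derivative \<rho> * (e (s - \<rho>) - e (s + \<rho>))) (at \<rho>)" for \<rho>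
    unfolding P_def by (rule derivative_eq_intros shift[OF Z] shift[OF w] refl)+ (simp add: algebra_simps)
  have Q: "(Q has_real_derivative r * (e (s - \<rho>) - e (s + \<rho>))) (at \<rho>)" for \<rho>
    unfolding Q_def by (rule derivative_eq_intros shift[OF w] refl)+ (simp add: algebra_simps)
  have "((\<lambda>\<rho>. \<rho> * (e (s - \<rho>) - e (s + \<rho>))) has_integral (P r - P 0)) {0..r}"
    using r P by (intro fundamental_theorem_of_calculus)
      (auto simp flip: has_real_derivative_iff_has_vector_derivative intro: has_field_derivative_at_within)
  then have 1: "((\<lambda>\<rho>. min \<rho> r * (e (s - \<rho>) - e (s + \<rho>))) has_integral (P r - P 0)) {0..r}"
    by (rule has_integral_eq[rotated]) auto
  have "((\<lambda>\<rho>. r * (e (s - \<rho>) - e (s + \<rho>))) has_integral (Q R - Q r)) {r..R}"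
    using r Q by (intro fundamental_theorem_of_calculus)
      (auto simp flip: has_real_derivative_iff_has_vector_derivative intro: has_field_derivative_at_within)
  then have 2: "((\<lambda>\<rho>. min \<rho> r * (e (s - \<rho>) - e (s + \<rho>))) has_integral (Q R - Q r)) {r..R}"
    by (rule has_integral_eq[rotated]) auto
  have "(P r - P 0) + (Q R - Q r) = integral {s - r..s + r} w - r * (w (s + R) + w (s - R))"
    unfolding Iw P_def Q_def by (simp add: algebra_simps)
  then show ?thesis
    using has_integral_combine[OF r 1 2] by simp
qed

lemma has_real_derivative_eq_constant_diff:
  fixes f g :: "real \<Rightarrow> real"
  assumes "convex S" "\<And>x. x \<in> S \<Longrightarrow> (f has_real_derivative h x) (at x within S)"
    "\<And>x. x \<in> S \<Longrightarrow> (g has_real_derivative h x) (at x within S)" "x \<in> S" "y \<in> S"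
  shows "f y - f x = g y - g x"
proof -
  have "\<exists>c. \<forall>x\<in>S. f x - g x = c"
    using assms(1) by (rule has_field_derivative_zero_constant)
      (use DERIV_diff[OF assms(2) assms(3)] in auto)
  then obtain c where "\<And>x. x \<in> S \<Longrightarrow> f x - g x = c" by blast
  from this[OF assms(4)] this[OF assms(5)] show ?thesis by simp
qed

text \<open>Extending \<open>u\<close> by its end tangents corresponds to extending \<open>f\<close> by zero. It lets windows around any point
  of \<open>[-L, L]\<close> grow until they contain the whole interval, beyond which everything is explicit. The iterated
  antiderivative \<open>W\<close> is kept for integrals of the extension.\<close>

lemma tangent_extension:
  fixes u u' :: "real \<Rightarrow> real"
  assumes L: "L \<ge> 0"
    and u: "\<forall>x\<in>{-L..L}. (u has_real_derivative u' x) (at x within {-L..L})"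
    and c: "continuous_on {-L..L} u'"
  obtains w W where "\<And>x. (w has_real_derivative u' (max (-L) (min L x))) (at x)"
    "\<And>x. (W has_real_derivative w x) (at x)"
    "\<And>x. x \<in> {-L..L} \<Longrightarrow> w x = u x"
    "\<And>x. x \<ge> L \<Longrightarrow> w x = u L + (x - L) * u' L"
    "\<And>x. x \<le> -L \<Longrightarrow> w x = u (-L) + (x + L) * u' (-L)"
    "\<And>x. x \<ge> L \<Longrightarrow> W x = W L + (x - L) * u L + (x - L)\<^sup>2 / 2 * u' L"
    "\<And>x. x \<le> -L \<Longrightarrow> W x = W (-L) + (x + L) * u (-L) + (x + L)\<^sup>2 / 2 * u' (-L)"
proof -
  define e where "e = (\<lambda>x. u' (max (-L) (min L x)))"
  have "continuous_on UNIV e"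
    unfolding e_def by (rule continuous_on_compose2[OF c]) (use L in \<open>auto intro!: continuous_intros\<close>)
  then obtain w0 where w0: "\<And>x. (w0 has_real_derivative e x) (at x)"
    using real_continuous_antiderivative by blast
  define w where "w = (\<lambda>x. w0 x - w0 0 + u 0)"
  have w: "(w has_real_derivative e x) (at x)" for x
    unfolding w_def by (rule derivative_eq_intros w0 refl)+ simp
  have "continuous_on UNIV w"
    using w by (meson DERIV_isCont continuous_at_imp_continuous_on)
  then obtain W where W: "\<And>x. (W has_real_derivative w x) (at x)"
    using real_continuous_antiderivative by blast
  have w_eq: "w x = u x" if "x \<in> {-L..L}" for x
  proof -
    have "w x - w 0 = u x - u 0"
    proof (rule has_real_derivative_eq_constant_diff)
      show "(w has_real_derivative u' y) (at y within {-L..L})" if "y \<in> {-L..L}" for y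
        using w[of y] that by (auto simp: e_def min_absorb2 max_absorb2 intro: has_field_derivative_at_within)
    qed (use u that L in auto)
    then show ?thesis by (simp add: w_def)
  qed
  have wR: "w x = u L + (x - L) * u' L" if "x \<ge> L" for x
  proof -
    have "w x - w L = (x - L) * u' L - (L - L) * u' L"
    proof (rule has_real_derivative_eq_constant_diff[where S = "{L..}" and h = "\<lambda>_. u' L"])
      show "(w has_real_derivative u' L) (at y within {L..})" if "y \<in> {L..}" for y
        using w[of y] that L by (auto simp: e_def min_absorb1 max_absorb2 intro: has_field_derivative_at_within)
    qed (use that in \<open>auto intro!: derivative_eq_intros\<close>)
    then show ?thesis using w_eq[of L] L by simp
  qed
  have wL: "w x = u (-L) + (x + L) * u' (-L)" if "x \<le> -L" for x
  proof -
    have "w x - w (-L) = (x + L) * u' (-L) - (-L + L) * u' (-L)"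
    proof (rule has_real_derivative_eq_constant_diff[where S = "{..-L}" and h = "\<lambda>_. u' (-L)"])
      show "(w has_real_derivative u' (-L)) (at y within {..-L})" if "y \<in> {..-L}" for y
        using w[of y] that L by (auto simp: e_def min_absorb2 max_absorb1 intro: has_field_derivative_at_within)
    qed (use that in \<open>auto intro!: derivative_eq_intros\<close>)
    then show ?thesis using w_eq[of "-L"] L by simp
  qed
  have WR: "W x = W L + (x - L) * u L + (x - L)\<^sup>2 / 2 * u' L" if "x \<ge> L" for x
  proof -
    define g where "g = (\<lambda>x. (x - L) * u L + (x - L)\<^sup>2 / 2 * u' L)"
    have "W x - W L = g x - g L"
    proof (rule has_real_derivative_eq_constant_diff[where S = "{L..}" and h = w])
      show "(g has_real_derivative w y) (at y within {L..})" if "y \<in> {L..}" for y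
        using that wR[of y] unfolding g_def by (auto intro!: derivative_eq_intros)
    qed (use that in \<open>auto intro: has_field_derivative_at_within[OF W]\<close>)
    then show ?thesis by (simp add: g_def)
  qed
  have WL: "W x = W (-L) + (x + L) * u (-L) + (x + L)\<^sup>2 / 2 * u' (-L)" if "x \<le> -L" for x
  proof -
    define g where "g = (\<lambda>x. (x + L) * u (-L) + (x + L)\<^sup>2 / 2 * u' (-L))"
    have "W x - W (-L) = g x - g (-L)"
    proof (rule has_real_derivative_eq_constant_diff[where S = "{..-L}" and h = w])
      show "(g has_real_derivative w y) (at y within {..-L})" if "y \<in> {..-L}" for y
        using that wL[of y] unfolding g_def by (auto intro!: derivative_eq_intros)
    qed (use that in \<open>auto intro: has_field_derivative_at_within[OF W]\<close>)
    then show ?thesis by (simp add: g_def)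
  qed
  show thesis
  proof (rule that[of w W])
    show "(w has_real_derivative u' (max (-L) (min L x))) (at x)" for x
      using w[of x] by (simp only: e_def)
  qed (rule W w_eq wR wL WR WL, assumption?)+
qed

text \<open>Let \<open>m \<rho>\<close>, \<open>n \<rho>\<close> and \<open>k \<rho>\<close> be the masses of \<open>f\<close> in the windows of radius \<open>\<rho>\<close> around
  \<open>s\<close> and \<open>- s\<close>, and of \<open>f\<^sup>#\<close> in the centred window, so that \<open>m, n \<le> k\<close>. Folding both integrals shows that
  \<open>B - A = \<integral> min \<rho> r (k - m) d\<rho> - r s (u' L + u' (-L))\<close> over \<open>[0, 2 L]\<close>. The last summand has no definite sign,
  but by the Robin conditions it equals \<open>r c \<integral> \<rho> (m - n) d\<rho>\<close>. Hence
  \<open>B - A = \<integral> (min \<rho> r - r c \<rho>) (k - m) + r c \<rho> (k - n) d\<rho>\<close>, and both weights are nonnegative because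
  \<open>2 c L \<le> 1\<close>. The two terms correspond to the kernels in \<open>x - y\<close> and \<open>x + y\<close> of the Green function.\<close>

lemma robin_interval_comparison:
  fixes u v u' v' :: "real \<Rightarrow> real"
  assumes L: "L > 0" and \<alpha>: "\<alpha> > 0"
    and u: "\<forall>x\<in>{-L..L}. (u has_real_derivative u' x) (at x within {-L..L})"
      "continuous_on {-L..L} u'" "- u' (-L) + \<alpha> * u (-L) = 0" "u' L + \<alpha> * u L = 0"
    and v: "\<forall>x\<in>{-L..L}. (v has_real_derivative v' x) (at x within {-L..L})"
      "continuous_on {-L..L} v'" "- v' (-L) + \<alpha> * v (-L) = 0" "v' L + \<alpha> * v L = 0"
    and v_dec: "\<And>x y. \<lbrakk>-L \<le> x; x \<le> y; y \<le> L\<rbrakk> \<Longrightarrow> v' y \<le> v' x"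
    and conc: "\<And>x y. \<lbrakk>-L \<le> x; x \<le> y; y \<le> L\<rbrakk> \<Longrightarrow> 
                 u' x - u' y \<le> v' (- ((y - x) / 2)) - v' ((y - x) / 2)"
    and total: "u' (-L) - u' L = v' (-L) - v' L"
    and r: "0 \<le> r" "-L \<le> s - r" "s + r \<le> L"
  shows "integral {s - r..s + r} u \<le> integral {-r..r} v"
proof -
  have L0: "L \<ge> 0" using L by simp
  define \<kappa> where "\<kappa> = (\<lambda>x. max (-L) (min L x))"
  obtain w W where w: "\<And>x. (w has_real_derivative u' (\<kappa> x)) (at x)"
    "\<And>x. (W has_real_derivative w x) (at x)"
    "\<And>x. x \<in> {-L..L} \<Longrightarrow> w x = u x"
    "\<And>x. x \<ge> L \<Longrightarrow> w x = u L + (x - L) * u' L"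
    "\<And>x. x \<le> -L \<Longrightarrow> w x = u (-L) + (x + L) * u' (-L)"
    "\<And>x. x \<ge> L \<Longrightarrow> W x = W L + (x - L) * u L + (x - L)\<^sup>2 / 2 * u' L"
    "\<And>x. x \<le> -L \<Longrightarrow> W x = W (-L) + (x + L) * u (-L) + (x + L)\<^sup>2 / 2 * u' (-L)"
    unfolding \<kappa>_def by (rule tangent_extension[OF L0 u(1) u(2)]) blast
  obtain z Z where z: "\<And>x. (z has_real_derivative v' (\<kappa> x)) (at x)"
    "\<And>x. (Z has_real_derivative z x) (at x)"
    "\<And>x. x \<in> {-L..L} \<Longrightarrow> z x = v x"
    "\<And>x. x \<ge> L \<Longrightarrow> z x = v L + (x - L) * v' L"
    "\<And>x. x \<le> -L \<Longrightarrow> z x = v (-L) + (x + L) * v' (-L)"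
    unfolding \<kappa>_def by (rule tangent_extension[OF L0 v(1) v(2)]) blast
  define p q where "p = u' L" and "q = u' (-L)"
  have bu: "u L = - p / \<alpha>" "u (-L) = q / \<alpha>"
    using u(3,4) \<alpha> by (auto simp: p_def q_def field_simps)
  have bv: "v L = - v' L / \<alpha>" "v (-L) = v' (-L) / \<alpha>"
    using v(3,4) \<alpha> by (auto simp: field_simps)
  (* at radius 2 L the windows around s and - s both contain the whole interval *)
  define R where "R = 2 * L"
  have R: "r \<le> R" "0 \<le> R" "-L \<le> s" "s \<le> L" "r \<le> L" using r L by (auto simp: R_def)
  define m where "m = (\<lambda>\<rho>. u' (\<kappa> (s - \<rho>)) - u' (\<kappa> (s + \<rho>)))"
  define n where "n = (\<lambda>\<rho>. u' (\<kappa> (- s - \<rho>)) - u' (\<kappa> (- s + \<rho>)))"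
  define k where "k = (\<lambda>\<rho>. v' (\<kappa> (- \<rho>)) - v' (\<kappa> \<rho>))"
  define A where "A = integral {s - r..s + r} u"
  define B where "B = integral {-r..r} v"
  have hm: "((\<lambda>\<rho>. min \<rho> r * m \<rho>) has_integral (A - r * ((q - p) / \<alpha> + s * (p + q) + L * (p - q)))) {0..R}"
  proof -
    have "integral {s - r..s + r} w = A"
      unfolding A_def by (rule integral_cong) (use w(3) r in auto)
    moreover have "w (s + R) + w (s - R) = (q - p) / \<alpha> + s * (p + q) + L * (p - q)"
      using w(4)[of "s + R"] w(5)[of "s - R"] R bu
      by (simp add: R_def p_def q_def diff_divide_distrib) (simp add: algebra_simps)
    ultimately show ?thesis
      using folded_integral[OF w(1) r(1) R(1), of s] by (simp add: m_def)
  qed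
  have hk: "((\<lambda>\<rho>. min \<rho> r * k \<rho>) has_integral (B - r * ((q - p) / \<alpha> + L * (p - q)))) {0..R}"
  proof -
    have "integral {-r..r} z = B"
      unfolding B_def by (rule integral_cong) (use z(3) r in auto)
    moreover have "z R + z (-R) = (v' (-L) - v' L) / \<alpha> - L * (v' (-L) - v' L)"
      using z(4)[of R] z(5)[of "-R"] L bv
      by (simp add: R_def diff_divide_distrib) (simp add: algebra_simps)
    then have "z R + z (-R) = (q - p) / \<alpha> + L * (p - q)"
      unfolding total[symmetric] p_def[symmetric] q_def[symmetric] by (simp add: algebra_simps)
    ultimately show ?thesis
      using folded_integral[OF z(1) r(1) R(1), of 0] by (simp add: k_def)
  qed
  have full: "((\<lambda>\<rho>. \<rho> * (u' (\<kappa> (t - \<rho>)) - u' (\<kappa> (t + \<rho>)))) has_integral 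
     (W (t + R) - W (t - R) - R * (w (t + R) + w (t - R)))) {0..R}" for t
  proof -
    have "integral {t - R..t + R} w = W (t + R) - W (t - R)"
      using R w(2) by (intro integral_unique fundamental_theorem_of_calculus)
        (auto simp flip: has_real_derivative_iff_has_vector_derivative intro: has_field_derivative_at_within)
    with folded_integral[OF w(1) R(2) order_refl, of t]
    show ?thesis
      by (auto intro: has_integral_eq[rotated])
  qed
  define c where "c = \<alpha> / (2 * (1 + \<alpha> * L))"
  have c0: "c > 0" using \<alpha> L by (simp add: c_def add_pos_pos)
  have cR: "c * R \<le> 1" using \<alpha> L by (simp add: c_def R_def field_simps add_pos_pos)
  have ceq: "2 * c * (1 / \<alpha> + L) = 1"
  proof -
    have "1 / \<alpha> + L = (1 + \<alpha> * L) / \<alpha>" using \<alpha> by (simp add: add_divide_distrib)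
    moreover have "1 + \<alpha> * L > 0" using \<alpha> L by (simp add: add_pos_pos)
    ultimately show ?thesis using \<alpha> by (simp add: c_def)
  qed
  (* The second moments of f about s and - s differ by a multiple of its first moment, which the
     boundary conditions express through p + q. *)
  have hmn: "((\<lambda>\<rho>. \<rho> * m \<rho> - \<rho> * n \<rho>) has_integral (- 2 * s * (p + q) * (1 / \<alpha> + L))) {0..R}"
  proof -
    have "(W (s + R) - W (s - R) - R * (w (s + R) + w (s - R))) 
        - (W (- s + R) - W (- s - R) - R * (w (- s + R) + w (- s - R))) = - 2 * s * (p + q) * (1 / \<alpha> + L)"
      using w(4)[of "s + R"] w(5)[of "s - R"] w(4)[of "-s + R"] w(5)[of "-s - R"]
        w(6)[of "s + R"] w(7)[of "s - R"] w(6)[of "-s + R"] w(7)[of "-s - R"] R bu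
      by (simp add: R_def flip: p_def q_def) (simp add: algebra_simps power2_eq_square add_divide_distrib diff_divide_distrib)
    with has_integral_diff[OF full[of s] full[of "-s"]] show ?thesis
      by (simp add: m_def n_def)
  qed
  have k_bound: "u' (\<kappa> (t - \<rho>)) - u' (\<kappa> (t + \<rho>)) \<le> k \<rho>" if "\<rho> \<ge> 0" for t \<rho>
  proof -
    define x y where "x = \<kappa> (t - \<rho>)" and "y = \<kappa> (t + \<rho>)"
    have xy: "-L \<le> x" "x \<le> y" "y \<le> L" "y - x \<le> 2 * \<rho>"
      using that L by (auto simp: x_def y_def \<kappa>_def)
    define h where "h = (y - x) / 2"
    have "2 * h = y - x" by (simp add: h_def)
    then have h: "0 \<le> h" "h \<le> \<rho>" "h \<le> L" using xy by linarith+
    have "u' x - u' y \<le> v' (- h) - v' h"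
      unfolding h_def by (rule conc[OF xy(1-3)])
    also have "\<dots> \<le> v' (\<kappa> (- \<rho>)) - v' (\<kappa> \<rho>)"
      by (intro diff_mono v_dec) (use h L in \<open>auto simp: \<kappa>_def\<close>)
    finally show ?thesis by (simp add: x_def y_def k_def)
  qed
  have "((\<lambda>\<rho>. min \<rho> r * k \<rho> - min \<rho> r * m \<rho> + r * c * (\<rho> * m \<rho> - \<rho> * n \<rho>)) has_integral
      ((B - r * ((q - p) / \<alpha> + L * (p - q))) - (A - r * ((q - p) / \<alpha> + s * (p + q) + L * (p - q))) 
        + r * c * (- 2 * s * (p + q) * (1 / \<alpha> + L)))) {0..R}"
    by (intro has_integral_add has_integral_diff has_integral_mult_right hm hk hmn)
  also have "(B - r * ((q - p) / \<alpha> + L * (p - q))) - (A - r * ((q - p) / \<alpha> + s * (p + q) + L * (p - q))) 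
        + r * c * (- 2 * s * (p + q) * (1 / \<alpha> + L)) 
      = B - A + r * s * (p + q) * (1 - 2 * c * (1 / \<alpha> + L))"
    by (simp add: algebra_simps)
  also have "\<dots> = B - A"
    by (simp only: ceq) simp
  finally have "((\<lambda>\<rho>. min \<rho> r * k \<rho> - min \<rho> r * m \<rho> + r * c * (\<rho> * m \<rho> - \<rho> * n \<rho>)) has_integral (B - A)) {0..R}"
    .
  then have "0 \<le> B - A"
  proof (rule has_integral_nonneg)
    fix \<rho> assume \<rho>: "\<rho> \<in> {0..R}"
    (* since c * R <= 1 bounds both c * \<rho> and c * r *)
    have "r * c * \<rho> \<le> min \<rho> r"
    proof -
      have "c * \<rho> \<le> c * R" using \<rho> c0 by auto
      then have "r * (c * \<rho>) \<le> r * 1" using cR r(1) by (intro mult_left_mono) auto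
      moreover have "c * r \<le> c * R" using R c0 by auto
      then have "\<rho> * (c * r) \<le> \<rho> * 1" using cR \<rho> by (intro mult_left_mono) auto
      ultimately show ?thesis by (simp add: mult_ac)
    qed
    moreover have "m \<rho> \<le> k \<rho>" "n \<rho> \<le> k \<rho>"
      using k_bound[of \<rho> s] k_bound[of \<rho> "-s"] \<rho> by (auto simp: m_def n_def)
    ultimately have "0 \<le> (min \<rho> r - r * c * \<rho>) * (k \<rho> - m \<rho>) + r * c * \<rho> * (k \<rho> - n \<rho>)"
      using r(1) c0 \<rho> by (intro add_nonneg_nonneg mult_nonneg_nonneg) auto
    then show "0 \<le> min \<rho> r * k \<rho> - min \<rho> r * m \<rho> + r * c * (\<rho> * m \<rho> - \<rho> * n \<rho>)"
      by (simp add: algebra_simps)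
  qed
  then show ?thesis by (simp add: A_def B_def)
qed

section \<open>From intervals to increasing convex functions\<close>

text \<open>The part of concavity that makes superlevel sets intervals.\<close>

lemma antitone_derivative_quasiconcave:
  fixes u u' :: "real \<Rightarrow> real"
  assumes u: "\<forall>x\<in>{a..b}. (u has_real_derivative u' x) (at x within {a..b})"
    and dec: "\<And>x y. \<lbrakk>a \<le> x; x \<le> y; y \<le> b\<rbrakk> \<Longrightarrow> u' y \<le> u' x"
    and x: "a \<le> x" "x \<le> y" "y \<le> z" "z \<le> b"
  shows "min (u x) (u z) \<le> u y"
proof (rule ccontr)
  assume "\<not> min (u x) (u z) \<le> u y"
  then have less: "u y < u x" "u y < u z" by auto
  then have "x \<noteq> y" "y \<noteq> z" by auto
  then have ne: "x < y" "y < z" using x by linarith+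
  have mvt: "\<exists>\<xi>\<in>{p<..<q}. u q - u p = u' \<xi> * (q - p)" if "a \<le> p" "p < q" "q \<le> b" for p q
  proof (rule mvt_simple[OF that(2)])
    fix t assume t: "p \<le> t" "t \<le> q"
    then have "(u has_real_derivative u' t) (at t within {a..b})" using u that by simp
    then have "(u has_real_derivative u' t) (at t within {p..q})"
      by (rule has_field_derivative_subset) (use that in auto)
    then show "(u has_derivative (*) (u' t)) (at t within {p..q})"
      by (simp only: has_field_derivative_def)
  qed
  obtain \<xi> where \<xi>: "\<xi> \<in> {x<..<y}" "u y - u x = u' \<xi> * (y - x)"
    using mvt[of x y] ne x by auto
  obtain \<eta> where \<eta>: "\<eta> \<in> {y<..<z}" "u z - u y = u' \<eta> * (z - y)"
    using mvt[of y z] ne x by auto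
  have "u' \<xi> * (y - x) < 0" "u' \<eta> * (z - y) > 0"
    using less \<xi>(2) \<eta>(2) by linarith+
  then have "u' \<xi> < 0" "u' \<eta> > 0"
    using ne by (auto simp: mult_less_0_iff zero_less_mult_iff)
  moreover have "u' \<eta> \<le> u' \<xi>" using dec[of \<xi> \<eta>] \<xi>(1) \<eta>(1) x by auto
  ultimately show False by simp
qed

text \<open>The superlevel set \<open>{u > c}\<close> is an interval with some end points \<open>a\<close>, \<open>b\<close>, so \<open>\<integral> (u - c)\<^sup>+\<close> is an integral
  of \<open>u - c\<close> over it. Comparison replaces it by an integral of \<open>v - c\<close> over the centred interval of the same
  length, which is at most \<open>\<integral> (v - c)\<^sup>+\<close> whether or not \<open>v > c\<close> there.\<close>

lemma integral_pos_part_le_of_interval_comparison: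
  fixes u v :: "real \<Rightarrow> real"
  assumes cont: "continuous_on {-L..L} u" "continuous_on {-L..L} v"
    and quasi: "\<And>x y z. \<lbrakk>-L \<le> x; x \<le> y; y \<le> z; z \<le> L\<rbrakk> \<Longrightarrow> min (u x) (u z) \<le> u y"
    and comp: "\<And>s r. \<lbrakk>0 \<le> r; -L \<le> s - r; s + r \<le> L\<rbrakk> \<Longrightarrow>
                   integral {s - r..s + r} u \<le> integral {-r..r} v"
  shows "integral {-L..L} (\<lambda>x. max (u x - c) 0) \<le> integral {-L..L} (\<lambda>x. max (v x - c) 0)"
proof -
  have int_v: "(\<lambda>x. max (v x - c) 0) integrable_on {-L..L}"
    by (intro integrable_continuous_real continuous_intros cont)
  have nonneg: "0 \<le> integral {-L..L} (\<lambda>x. max (v x - c) 0)"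
    by (rule integral_nonneg[OF int_v]) auto
  define S where "S = {x\<in>{-L..L}. c < u x}"
  show ?thesis
  proof (cases "S = {}")
    case True
    have "integral {-L..L} (\<lambda>x. max (u x - c) 0) = integral {-L..L} (\<lambda>x. 0)"
      by (rule integral_cong) (use True in \<open>force simp: S_def\<close>)
    then show ?thesis using nonneg by simp
  next
    case False
    define a b where "a = Inf S" and "b = Sup S"
    have bdd: "bdd_below S" "bdd_above S" by (auto simp: S_def bdd_below_def bdd_above_def)
    have ab_L: "-L \<le> a" "b \<le> L"
      unfolding a_def b_def using False by (auto intro!: cInf_greatest cSup_least simp: S_def)
    obtain x0 where "x0 \<in> S" using False by blast
    then have ab: "a \<le> b" unfolding a_def b_def using bdd cInf_lower cSup_upper by (meson order_trans)
    have out: "x \<in> {a..b}" if "x \<in> S" for x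
      unfolding a_def b_def using bdd that by (auto intro: cInf_lower cSup_upper)
    have inside: "c < u x" if x: "x \<in> {a<..<b}" for x
    proof -
      obtain p where p: "p \<in> S" "p < x" using x cInf_lessD[OF False] by (auto simp: a_def)
      obtain q where q: "q \<in> S" "x < q" using x less_cSup_iff[OF False bdd(2)] by (auto simp: b_def)
      have "min (u p) (u q) \<le> u x" using p q quasi[of p x q] by (auto simp: S_def)
      then show ?thesis using p(1) q(1) by (auto simp: S_def)
    qed
    define s r where "s = (a + b) / 2" and "r = (b - a) / 2"
    have sr: "s - r = a" "s + r = b" "0 \<le> r" "2 * r = b - a" using ab by (auto simp: s_def r_def field_simps)
    have r_L: "-L \<le> -r" "r \<le> L" using ab_L sr by auto
    have sub: "{a..b} \<subseteq> {-L..L}" "{-r..r} \<subseteq> {-L..L}" using ab_L r_L by auto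
    have "integral {-L..L} (\<lambda>x. max (u x - c) 0) = integral {a..b} (\<lambda>x. max (u x - c) 0)"
    proof -
      have "integral {-L..L} (\<lambda>x. max (u x - c) 0)
          = integral {-L..L} (\<lambda>x. if x \<in> {a..b} then max (u x - c) 0 else 0)"
        by (rule integral_cong) (use out in \<open>force simp: S_def\<close>)
      then show ?thesis using sub(1) by (simp only: integral_restrict_Int Int_absorb2)
    qed
    also have "\<dots> = integral {a..b} (\<lambda>x. u x - c)"
      by (rule integral_spike[of "{a, b}"]) (use inside in \<open>auto simp: less_le\<close>)
    also have "\<dots> = integral {a..b} u - c * (b - a)"
      using ab by (subst integral_diff)
        (auto intro!: integrable_continuous_real continuous_on_subset[OF cont(1) sub(1)])
    also have "\<dots> \<le> integral {-r..r} v - c * (b - a)"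
      using comp[of r s] sr ab_L by simp
    also have "\<dots> = integral {-r..r} (\<lambda>x. v x - c)"
      using sr by (subst integral_diff)
        (auto intro!: integrable_continuous_real continuous_on_subset[OF cont(2) sub(2)])
    also have "\<dots> \<le> integral {-r..r} (\<lambda>x. max (v x - c) 0)"
      by (intro integral_le integrable_continuous_real continuous_intros continuous_on_subset[OF cont(2) sub(2)]) auto
    also have "\<dots> \<le> integral {-L..L} (\<lambda>x. max (v x - c) 0)"
      by (rule integral_subset_le[OF sub(2) _ int_v])
        (auto intro!: integrable_continuous_real continuous_intros continuous_on_subset[OF cont(2) sub(2)])
    finally show ?thesis .
  qed
qed

text \<open>Piecewise linear interpolation at equidistant nodes \<open>x i\<close>, built one hinge at a time: the coefficient of the
  hinge at \<open>x n\<close> is the increase of the slope there, nonnegative by convexity. The slope to the left of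
  \<open>x 0\<close> is taken as \<open>0\<close>, and the first increase is nonnegative because \<open>\<phi>\<close> is increasing. On each cell both \<open>\<phi>\<close> and its interpolant lie between the two nodal values, so uniform
  continuity bounds the error. The predicate \<open>P\<close> abstracts the property to be transported to \<open>\<phi>\<close>.\<close>

lemma increasing_convex_approximation:
  fixes \<phi> :: "real \<Rightarrow> real"
  assumes \<phi>: "mono \<phi>" "convex_on UNIV \<phi>" and \<epsilon>: "\<epsilon> > 0" and m: "m \<le> M"
    and P_const: "\<And>c. P (\<lambda>_. c)"
    and P_hinge: "\<And>g a c. \<lbrakk>P g; 0 \<le> a\<rbrakk> \<Longrightarrow> P (\<lambda>t. g t + a * max (t - c) 0)"
  obtains g where "P g" "\<And>t. t \<in> {m..M} \<Longrightarrow> \<bar>g t - \<phi> t\<bar> \<le> \<epsilon>"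
proof -
  (* the last node may lie beyond M by less than the mesh size, which is at most 1 *)
  have cont: "continuous_on {m..M+1} \<phi>"
    using convex_on_continuous[OF open_UNIV \<phi>(2)] continuous_on_subset by blast
  then have "uniformly_continuous_on {m..M+1} \<phi>"
    by (rule compact_uniformly_continuous) simp
  then obtain d where d: "d > 0" "\<And>s t. \<lbrakk>s \<in> {m..M+1}; t \<in> {m..M+1}; dist t s < d\<rbrakk> \<Longrightarrow> dist (\<phi> t) (\<phi> s) < \<epsilon>"
    using \<epsilon> unfolding uniformly_continuous_on_def by metis
  define h where "h = min (d / 2) 1"
  have h: "h > 0" "h < d" "h \<le> 1" using d(1) by (auto simp: h_def)
  define x where "x = (\<lambda>i::nat. m + real i * h)"
  have xS: "x (Suc i) = x i + h" for i by (simp add: x_def algebra_simps)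
  define \<sigma> where "\<sigma> = (\<lambda>i. if i = 0 then 0 else (\<phi> (x i) - \<phi> (x (i - 1))) / h)"
  have \<sigma>_mono: "\<sigma> i \<le> \<sigma> (Suc i)" for i
  proof (cases i)
    case 0
    then show ?thesis using h by (auto simp: \<sigma>_def xS intro!: divide_nonneg_pos monoD[OF \<phi>(1)])
  next
    case (Suc j)
    have "\<phi> (x i) \<le> 1/2 * \<phi> (x j) + 1/2 * \<phi> (x (Suc i))"
    proof -
      have "\<phi> ((1 - 1/2) *\<^sub>R x j + (1/2) *\<^sub>R x (Suc i)) \<le> (1 - 1/2) * \<phi> (x j) + 1/2 * \<phi> (x (Suc i))"
        by (rule convex_onD[OF \<phi>(2)]) auto
      moreover have "(1 - 1/2) *\<^sub>R x j + (1/2) *\<^sub>R x (Suc i) = x i"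
        using Suc by (simp add: xS field_simps)
      ultimately show ?thesis by simp
    qed
    then show ?thesis using Suc h by (auto simp: \<sigma>_def intro!: divide_right_mono)
  qed
  have step: "\<exists>g. P g \<and> (\<forall>t\<ge>x n. g t = \<phi> (x n) + \<sigma> n * (t - x n)) 
      \<and> (\<forall>t\<in>{m..x n}. \<bar>g t - \<phi> t\<bar> \<le> \<epsilon>)" if "x n \<le> M + 1" for n
    using that
  proof (induction n)
    case 0
    then show ?case
      using P_const[of "\<phi> m"] \<epsilon> by (intro exI[of _ "\<lambda>_. \<phi> m"]) (auto simp: x_def \<sigma>_def)
  next
    case (Suc n)
    then have "x n \<le> M + 1" using h by (simp add: xS)
    with Suc.IH obtain g where g: "P g" "\<And>t. t \<ge> x n \<Longrightarrow> g t = \<phi> (x n) + \<sigma> n * (t - x n)"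
       "\<And>t. t \<in> {m..x n} \<Longrightarrow> \<bar>g t - \<phi> t\<bar> \<le> \<epsilon>" by blast
    define G where "G = (\<lambda>t. g t + (\<sigma> (Suc n) - \<sigma> n) * max (t - x n) 0)"
    have "P G" unfolding G_def using \<sigma>_mono[of n] by (intro P_hinge g) auto
    have G_eq: "G t = \<phi> (x n) + \<sigma> (Suc n) * (t - x n)" if "t \<ge> x n" for t
      using g(2)[OF that] that by (simp add: G_def max_absorb1 algebra_simps)
    have slope: "\<sigma> (Suc n) * h = \<phi> (x (Suc n)) - \<phi> (x n)"
      using h by (simp add: \<sigma>_def)
    have s0: "\<sigma> (Suc n) \<ge> 0"
      using h by (auto simp: \<sigma>_def xS intro!: divide_nonneg_pos monoD[OF \<phi>(1)])
    have "G t = \<phi> (x (Suc n)) + \<sigma> (Suc n) * (t - x (Suc n))" if "t \<ge> x (Suc n)" for t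
      using G_eq[of t] that slope h by (simp add: xS algebra_simps)
    moreover have "\<bar>G t - \<phi> t\<bar> \<le> \<epsilon>" if t: "t \<in> {m..x (Suc n)}" for t
    proof (cases "t \<le> x n")
      case True
      then show ?thesis using g(3)[of t] t by (simp add: G_def)
    next
      case False
      have "m \<le> x n" using h by (simp add: x_def)
      have "\<bar>\<phi> (x (Suc n)) - \<phi> (x n)\<bar> < \<epsilon>"
        using d(2)[of "x n" "x (Suc n)"] Suc.prems \<open>m \<le> x n\<close> h by (auto simp: xS dist_real_def)
      moreover have "\<phi> (x n) \<le> \<phi> t" "\<phi> t \<le> \<phi> (x (Suc n))"
        using False t by (auto intro!: monoD[OF \<phi>(1)])
      moreover have "0 \<le> \<sigma> (Suc n) * (t - x n)" "\<sigma> (Suc n) * (t - x n) \<le> \<sigma> (Suc n) * h"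
        using False t s0 by (auto intro!: mult_left_mono simp: xS)
      ultimately show ?thesis using G_eq[of t] False slope by linarith
    qed
    ultimately show ?case using \<open>P G\<close> by blast
  qed
  define n where "n = nat \<lceil>(M - m) / h\<rceil>"
  have "(M - m) / h \<le> real n" "real n < (M - m) / h + 1"
    using m h ceiling_correct[of "(M - m) / h"] by (auto simp: n_def)
  then have n: "M - m \<le> real n * h" "real n * h < (M - m) + h"
    using h by (auto simp: field_simps)
  then have "x n \<le> M + 1" "M \<le> x n" using h by (auto simp: x_def)
  with step[of n] obtain g where g: "P g" "\<forall>t\<in>{m..x n}. \<bar>g t - \<phi> t\<bar> \<le> \<epsilon>" by blast
  show thesis
    by (rule that[OF g(1)]) (use g(2) \<open>M \<le> x n\<close> in auto)
qed

lemma integral_increasing_convex_le: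
  fixes u v \<phi> :: "real \<Rightarrow> real"
  assumes cont: "continuous_on {a..b} u" "continuous_on {a..b} v"
    and hinge: "\<And>c. integral {a..b} (\<lambda>x. max (u x - c) 0) \<le> integral {a..b} (\<lambda>x. max (v x - c) 0)"
    and \<phi>: "mono \<phi>" "convex_on UNIV \<phi>"
  shows "integral {a..b} (\<lambda>x. \<phi> (u x)) \<le> integral {a..b} (\<lambda>x. \<phi> (v x))"
proof (cases "a \<le> b")
  case ab: True
  have "compact (u ` {a..b} \<union> v ` {a..b})"
    using cont by (intro compact_Un compact_continuous_image) auto
  then obtain K where K: "\<And>y. y \<in> u ` {a..b} \<union> v ` {a..b} \<Longrightarrow> \<bar>y\<bar> \<le> K" 
    using compact_imp_bounded bounded_iff by (metis real_norm_def)
  have K0: "0 \<le> K" using K[of "u a"] ab by force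
  have \<phi>_cont: "continuous_on UNIV \<phi>" using convex_on_continuous[OF open_UNIV \<phi>(2)] .
  define P where "P = (\<lambda>g::real \<Rightarrow> real. continuous_on UNIV g \<and>
      integral {a..b} (\<lambda>x. g (u x)) \<le> integral {a..b} (\<lambda>x. g (v x)))"
  have compo: "(\<lambda>x. g (w x)) integrable_on {a..b}" if "continuous_on UNIV g" "continuous_on {a..b} w" for g w :: "real \<Rightarrow> real"
    by (rule integrable_continuous_real, rule continuous_on_compose2[OF that]) simp
  have P_const: "P (\<lambda>_. c)" for c by (simp add: P_def)
  have P_hinge: "P (\<lambda>t. g t + d * max (t - c) 0)" if "P g" "0 \<le> d" for g d c
  proof -
    have g: "continuous_on UNIV g" "integral {a..b} (\<lambda>x. g (u x)) \<le> integral {a..b} (\<lambda>x. g (v x))"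
      using that by (auto simp: P_def)
    have "integral {a..b} (\<lambda>x. g (w x) + d * max (w x - c) 0)
        = integral {a..b} (\<lambda>x. g (w x)) + d * integral {a..b} (\<lambda>x. max (w x - c) 0)" 
      if "continuous_on {a..b} w" for w
      using that by (subst integral_add) (auto intro!: compo[OF g(1)] integrable_continuous_real continuous_intros
        intro: continuous_on_compose2[OF g(1)])
    from this[OF cont(1)] this[OF cont(2)] show ?thesis
      unfolding P_def using g mult_left_mono[OF hinge[of c] that(2)]
      by (auto intro!: continuous_intros)
  qed
  show ?thesis
  proof (rule field_le_epsilon)
    fix e :: real assume "e > 0"
    define \<epsilon> where "\<epsilon> = e / (2 * (b - a + 1))"
    have \<epsilon>: "\<epsilon> > 0" "2 * (\<epsilon> * (b - a)) \<le> e"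
      using \<open>e > 0\<close> ab by (auto simp: \<epsilon>_def field_simps)
    obtain g where g: "P g" "\<And>t. t \<in> {-K..K} \<Longrightarrow> \<bar>g t - \<phi> t\<bar> \<le> \<epsilon>"
      using increasing_convex_approximation[OF \<phi> \<epsilon>(1), of "-K" K P] P_const P_hinge K0 by auto
    have gc: "continuous_on UNIV g" using g(1) by (simp add: P_def)
    have close: "\<bar>integral {a..b} (\<lambda>x. \<phi> (w x)) - integral {a..b} (\<lambda>x. g (w x))\<bar> \<le> \<epsilon> * (b - a)"
      if w: "continuous_on {a..b} w" "\<And>x. x \<in> {a..b} \<Longrightarrow> \<bar>w x\<bar> \<le> K" for w
    proof -
      have "norm (integral {a..b} (\<lambda>x. \<phi> (w x) - g (w x))) \<le> \<epsilon> * (b - a)"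
      proof (rule integral_bound[OF ab])
        show "continuous_on {a..b} (\<lambda>x. \<phi> (w x) - g (w x))"
          by (intro continuous_intros continuous_on_compose2[OF \<phi>_cont w(1)] continuous_on_compose2[OF gc w(1)]) auto
        show "norm (\<phi> (w t) - g (w t)) \<le> \<epsilon>" if "t \<in> {a..b}" for t
          using w(2)[OF that] g(2)[of "w t"] by (auto simp: abs_minus_commute abs_le_iff)
      qed
      then show ?thesis
        using integral_diff[OF compo[OF \<phi>_cont w(1)] compo[OF gc w(1)]] by simp
    qed
    have "integral {a..b} (\<lambda>x. g (u x)) \<le> integral {a..b} (\<lambda>x. g (v x))"
      using g(1) by (simp add: P_def)
    moreover have "\<bar>u x\<bar> \<le> K" "\<bar>v x\<bar> \<le> K" if "x \<in> {a..b}" for x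
      using K that by auto
    note close[OF cont(1) this(1)] close[OF cont(2) this(2)]
    ultimately show "integral {a..b} (\<lambda>x. \<phi> (u x)) \<le> integral {a..b} (\<lambda>x. \<phi> (v x)) + e"
      using \<epsilon>(2) unfolding abs_le_iff by linarith
  qed
next
  case False
  then have "{a..b} = {}" by simp
  then show ?thesis by (simp only: Henstock_Kurzweil_Integration.integral_empty)
qed

section \<open>Comparison of norms\<close>

text \<open>Two positive arguments are covered by convexity of \<open>t\<^sup>p\<close> on the open half-line. If one of them vanishes, the claim
  reduces to \<open>s\<^sup>p \<le> s\<close> for \<open>0 < s < 1\<close>.\<close>

lemma convex_on_pos_part_powr:
  fixes p :: real
  assumes p: "1 \<le> p"
  shows "convex_on UNIV (\<lambda>t. max t 0 powr p)"
proof (rule convex_onI)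
  fix t x y :: real assume t: "0 < t" "t < 1"
  define X Y where "X = max x 0" and "Y = max y 0"
  have XY: "0 \<le> X" "0 \<le> Y" by (auto simp: X_def Y_def)
  have "max ((1 - t) *\<^sub>R x + t *\<^sub>R y) 0 \<le> (1 - t) * X + t * Y"
    using t by (auto simp: X_def Y_def intro!: add_mono mult_left_mono add_nonneg_nonneg)
  then have "max ((1 - t) *\<^sub>R x + t *\<^sub>R y) 0 powr p \<le> ((1 - t) * X + t * Y) powr p"
    using p by (intro powr_mono2) auto
  also have "\<dots> \<le> (1 - t) * X powr p + t * Y powr p"
  proof -
    have scale: "(s * Z) powr p \<le> s * Z powr p" if "0 < s" "s < 1" "0 \<le> Z" for s Z :: real
    proof -
      have "s powr p \<le> s powr 1" using that p by (intro powr_mono') auto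
      then show ?thesis using that by (simp add: powr_mult mult_right_mono)
    qed
    show ?thesis
    proof (cases "X = 0 \<or> Y = 0")
      case True
      then show ?thesis using scale[of "1 - t" X] scale[of t Y] t XY p by auto
    next
      case False
      then have "X \<in> {0<..}" "Y \<in> {0<..}" using XY by auto
      then show ?thesis using convex_onD[OF powr_convex[OF p], of t X Y] t by auto
    qed
  qed
  finally show "max ((1 - t) *\<^sub>R x + t *\<^sub>R y) 0 powr p \<le> (1 - t) * max x 0 powr p + t * max y 0 powr p"
    by (simp add: X_def Y_def)
qed simp

lemma Lp_norm_on_mono_finite:
  fixes u v :: "real \<Rightarrow> real"
  assumes p: "1 \<le> p" "p < \<infinity>"
    and cont: "continuous_on {a..b} u" "continuous_on {a..b} v"
    and nonneg: "\<And>x. x \<in> {a..b} \<Longrightarrow> 0 \<le> u x" "\<And>x. x \<in> {a..b} \<Longrightarrow> 0 \<le> v x"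
    and le: "\<And>\<phi> :: real \<Rightarrow> real. \<lbrakk>mono \<phi>; convex_on UNIV \<phi>\<rbrakk> \<Longrightarrow>
               integral {a..b} (\<lambda>x. \<phi> (u x)) \<le> integral {a..b} (\<lambda>x. \<phi> (v x))"
  shows "Lp_norm_on {a..b} p u \<le> Lp_norm_on {a..b} p v"
proof -
  define q where "q = enn2real p"
  have q: "1 \<le> q"
    using enn2real_mono[OF p(1)] p(2) by (simp add: q_def)
  define \<phi> where "\<phi> = (\<lambda>t::real. max t 0 powr q)"
  have \<phi>: "mono \<phi>" "convex_on UNIV \<phi>"
    using q by (auto simp: \<phi>_def mono_def intro!: convex_on_pos_part_powr powr_mono2)
  have \<phi>_cont: "continuous_on UNIV \<phi>"
    by (rule convex_on_continuous[OF open_UNIV \<phi>(2)])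
  have eq: "(\<integral>\<^sup>+ x. ennreal (\<bar>w x\<bar> powr q) \<partial>lebesgue_on {a..b}) = ennreal (integral {a..b} (\<lambda>x. \<phi> (w x)))"
    "0 \<le> integral {a..b} (\<lambda>x. \<phi> (w x))"
    if w: "continuous_on {a..b} w" "\<And>x. x \<in> {a..b} \<Longrightarrow> 0 \<le> w x" for w
  proof -
    have c: "continuous_on {a..b} (\<lambda>x. \<phi> (w x))"
      by (rule continuous_on_compose2[OF \<phi>_cont w(1)]) simp
    have int: "integrable (lebesgue_on {a..b}) (\<lambda>x. \<phi> (w x))"
      by (rule continuous_imp_integrable_real[OF c])
    have "(\<integral>\<^sup>+ x. ennreal (\<bar>w x\<bar> powr q) \<partial>lebesgue_on {a..b}) = (\<integral>\<^sup>+ x. ennreal (\<phi> (w x)) \<partial>lebesgue_on {a..b})"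
      by (rule nn_integral_cong) (use w(2) in \<open>auto simp: \<phi>_def max_absorb1\<close>)
    also have "\<dots> = ennreal (integral\<^sup>L (lebesgue_on {a..b}) (\<lambda>x. \<phi> (w x)))"
      by (rule nn_integral_eq_integral[OF int]) (simp add: \<phi>_def)
    also have "integral\<^sup>L (lebesgue_on {a..b}) (\<lambda>x. \<phi> (w x)) = integral {a..b} (\<lambda>x. \<phi> (w x))"
      by (rule lebesgue_integral_eq_integral[OF int]) simp
    finally show "(\<integral>\<^sup>+ x. ennreal (\<bar>w x\<bar> powr q) \<partial>lebesgue_on {a..b}) = ennreal (integral {a..b} (\<lambda>x. \<phi> (w x)))" .
    show "0 \<le> integral {a..b} (\<lambda>x. \<phi> (w x))"
      by (rule integral_nonneg[OF integrable_continuous_real[OF c]]) (simp add: \<phi>_def)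
  qed
  have "Lp_norm_on {a..b} p w = ennreal (integral {a..b} (\<lambda>x. \<phi> (w x)) powr (1 / q))"
    if "continuous_on {a..b} w" "\<And>x. x \<in> {a..b} \<Longrightarrow> 0 \<le> w x" for w
    using p(2) eq[OF that] by (auto simp: Lp_norm_on_def Let_def q_def[symmetric])
  note this[OF cont(1) nonneg(1)] this[OF cont(2) nonneg(2)]
  moreover have "integral {a..b} (\<lambda>x. \<phi> (u x)) powr (1 / q) \<le> integral {a..b} (\<lambda>x. \<phi> (v x)) powr (1 / q)"
    using q eq(2)[OF cont(1) nonneg(1)] le[OF \<phi>] by (intro powr_mono2) auto
  ultimately show ?thesis by (simp add: ennreal_leI)
qed

text \<open>With \<open>c = ess sup \<bar>v\<bar>\<close> the hinge integral of \<open>v\<close> vanishes, hence so does that of \<open>u\<close>, and continuity gives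
  \<open>u \<le> c\<close> everywhere.\<close>

lemma Lp_norm_on_mono_infinity:
  fixes u v :: "real \<Rightarrow> real"
  assumes ab: "a < b" and cont: "continuous_on {a..b} u" "continuous_on {a..b} v"
    and nonneg: "\<And>x. x \<in> {a..b} \<Longrightarrow> 0 \<le> u x"
    and hinge: "\<And>c. integral {a..b} (\<lambda>x. max (u x - c) 0) \<le> integral {a..b} (\<lambda>x. max (v x - c) 0)"
  shows "Lp_norm_on {a..b} \<infinity> u \<le> Lp_norm_on {a..b} \<infinity> v"
proof (cases "Lp_norm_on {a..b} \<infinity> v = \<infinity>")
  case False
  then obtain c where c: "0 \<le> c" "Lp_norm_on {a..b} \<infinity> v = ennreal c"
    by (cases "Lp_norm_on {a..b} \<infinity> v") auto
  have ac: "AE x in lebesgue_on {a..b}. ennreal \<bar>v x\<bar> \<le> ennreal c"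
    using esssup_AE[of "\<lambda>x. ennreal \<bar>v x\<bar>" "lebesgue_on {a..b}"] c(2) by (simp add: Lp_norm_on_def)
  then have "AE x in lebesgue. x \<in> {a..b} \<longrightarrow> ennreal \<bar>v x\<bar> \<le> ennreal c"
    by (simp add: AE_restrict_space_iff)
  then have "AE x in lebesgue. x \<in> {a..b} \<longrightarrow> max (v x - c) 0 = 0"
    by eventually_elim (use c(1) in auto)
  then obtain N where N: "N \<in> null_sets lebesgue" "{x \<in> space lebesgue. \<not> (x \<in> {a..b} \<longrightarrow> max (v x - c) 0 = 0)} \<subseteq> N"
    unfolding eventually_ae_filter by blast
  have "integral {a..b} (\<lambda>x. max (v x - c) 0) = integral {a..b} (\<lambda>x. 0)"
    by (rule integral_spike[of N]) (use N in \<open>auto simp: negligible_iff_null_sets\<close>)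
  then have le: "integral {a..b} (\<lambda>x. max (u x - c) 0) \<le> 0" using hinge[of c] by simp
  have cm: "continuous_on {a..b} (\<lambda>x. max (u x - c) 0)"
    by (intro continuous_intros cont)
  have "0 \<le> integral {a..b} (\<lambda>x. max (u x - c) 0)"
    by (rule integral_nonneg[OF integrable_continuous_real[OF cm]]) simp
  with le have "integral {a..b} (\<lambda>x. max (u x - c) 0) = 0" by simp
  then have *: "\<forall>x\<in>{a..b}. max (u x - c) 0 = 0"
    using integral_eq_0_iff[OF cm ab] by simp
  have "esssup (lebesgue_on {a..b}) (\<lambda>x. ennreal \<bar>u x\<bar>) \<le> ennreal c"
  proof (rule esssup_I)
    have "u \<in> borel_measurable (lebesgue_on {a..b})"
      by (rule continuous_imp_measurable_on_sets_lebesgue[OF cont(1)]) simp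
    then show "(\<lambda>x. ennreal \<bar>u x\<bar>) \<in> borel_measurable (lebesgue_on {a..b})" by measurable
    show "AE x in lebesgue_on {a..b}. ennreal \<bar>u x\<bar> \<le> ennreal c"
    proof (rule AE_I2)
      fix x assume "x \<in> space (lebesgue_on {a..b})"
      then have "x \<in> {a..b}" by simp
      with * nonneg[of x] have "\<bar>u x\<bar> \<le> c" by (metis abs_of_nonneg diff_le_0_iff_le max.cobounded1)
      then show "ennreal \<bar>u x\<bar> \<le> ennreal c" by (rule ennreal_leI)
    qed
  qed
  then show ?thesis unfolding c(2) by (simp add: Lp_norm_on_def)
qed simp

section \<open>Solutions of the Robin problem\<close>

text \<open>All information in the equation is kept as an integral identity for \<open>u'\<close>. It is stated with \<open>real_of_ereal\<close>
  because the right-hand side may be infinite on a null set.\<close>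

lemma robin_poisson_solutionE:
  assumes "robin_poisson_solution a b \<alpha> F u"
  obtains u' where "\<forall>x\<in>{a..b}. (u has_real_derivative u' x) (at x within {a..b})"
    "continuous_on {a..b} u'" "- u' a + \<alpha> * u a = 0" "u' b + \<alpha> * u b = 0"
    "\<And>x y. \<lbrakk>a \<le> x; x \<le> y; y \<le> b\<rbrakk> \<Longrightarrow> ((\<lambda>t. real_of_ereal (F t)) has_integral (u' x - u' y)) {x..y}"
proof -
  obtain u' where u': "\<forall>x\<in>{a..b}. (u has_real_derivative u' x) (at x within {a..b})"
    "continuous_on {a..b} u'" "absolutely_continuous_on {a..b} u'"
    and ae: "AE x in lebesgue_on {a<..<b}. \<exists>u''. (u' has_real_derivative u'') (at x) \<and> ereal (- u'') = F x"
    and bc: "- u' a + \<alpha> * u a = 0" "u' b + \<alpha> * u b = 0"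
    using assms unfolding robin_poisson_solution_def by blast
  have ftc: "((\<lambda>t. real_of_ereal (F t)) has_integral (u' x - u' y)) {x..y}" if "a \<le> x" "x \<le> y" "y \<le> b" for x y
  proof -
    have "AE t in lebesgue. t \<in> {a<..<b} \<longrightarrow> (\<exists>u''. (u' has_real_derivative u'') (at t) \<and> ereal (- u'') = F t)"
      using ae by (simp add: AE_restrict_space_iff)
    then have "AE t in lebesgue. t \<in> {x<..<y} \<longrightarrow> (u' has_real_derivative - real_of_ereal (F t)) (at t)"
    proof eventually_elim
      case (elim t)
      show ?case
      proof
        assume "t \<in> {x<..<y}"
        with elim that obtain d where d: "(u' has_real_derivative d) (at t)" "ereal (- d) = F t" by auto
        from d(2) have "real_of_ereal (F t) = - d" by (metis real_of_ereal.simps(1))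
        with d(1) show "(u' has_real_derivative - real_of_ereal (F t)) (at t)" by simp
      qed
    qed
    then have "AE t in lebesgue_on {x<..<y}. (u' has_real_derivative - real_of_ereal (F t)) (at t)"
      by (simp add: AE_restrict_space_iff)
    then have "((\<lambda>t. - real_of_ereal (F t)) has_integral (u' y - u' x)) {x..y}"
      using that absolutely_continuous_on_subset[OF u'(3), of "{x..y}"]
      by (intro absolutely_continuous_on_has_integral) auto
    from has_integral_neg[OF this] show ?thesis by simp
  qed
  show thesis by (rule that[OF u'(1,2) bc ftc])
qed

lemma has_integral_nonneg_AE:
  fixes f :: "real \<Rightarrow> real"
  assumes f: "(f has_integral I) S" and ae: "AE x in lebesgue. x \<in> S \<longrightarrow> 0 \<le> f x"
  shows "0 \<le> I"
proof -
  obtain N where N: "N \<in> null_sets lebesgue" "{x \<in> space lebesgue. \<not> (x \<in> S \<longrightarrow> 0 \<le> f x)} \<subseteq> N"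
    using ae unfolding eventually_ae_filter by blast
  have "((\<lambda>x. max (f x) 0) has_integral I) S"
    by (rule has_integral_spike[OF _ _ f, of N]) (use N in \<open>auto simp: negligible_iff_null_sets\<close>)
  then show ?thesis by (rule has_integral_nonneg) auto
qed

text \<open>A quasiconcave function is smallest at an end point. If \<open>u a < 0\<close>, then
  \<open>u' a < 0\<close>, so \<open>u\<close> decreases and \<open>u b < 0\<close>, although \<open>u' b < 0\<close> forces \<open>u b > 0\<close>. The case
  \<open>u b < 0\<close> is the mirror image.\<close>

lemma robin_nonneg:
  fixes u u' :: "real \<Rightarrow> real"
  assumes ab: "a < b" and \<alpha>: "0 < \<alpha>"
    and u: "\<forall>x\<in>{a..b}. (u has_real_derivative u' x) (at x within {a..b})"
    and bc: "- u' a + \<alpha> * u a = 0" "u' b + \<alpha> * u b = 0"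
    and dec: "\<And>x y. \<lbrakk>a \<le> x; x \<le> y; y \<le> b\<rbrakk> \<Longrightarrow> u' y \<le> u' x"
    and x: "x \<in> {a..b}"
  shows "0 \<le> u x"
proof -
  have "\<exists>\<xi>\<in>{a<..<b}. u b - u a = u' \<xi> * (b - a)"
  proof (rule mvt_simple[OF ab])
    fix t assume "a \<le> t" "t \<le> b"
    then show "(u has_derivative (*) (u' t)) (at t within {a..b})"
      using u by (auto simp: has_field_derivative_def)
  qed
  then obtain \<xi> where \<xi>: "\<xi> \<in> {a<..<b}" "u b - u a = u' \<xi> * (b - a)" by blast
  have le: "u' b \<le> u' \<xi>" "u' \<xi> \<le> u' a" using dec[of \<xi> b] dec[of a \<xi>] \<xi>(1) by auto
  have sgn: "u' a = \<alpha> * u a" "u' b = - \<alpha> * u b" using bc by auto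
  have "0 \<le> u a"
  proof (rule ccontr)
    assume "\<not> 0 \<le> u a"
    then have "u' a < 0" using sgn(1) \<alpha> by (simp add: mult_pos_neg)
    then have "u' \<xi> < 0" "u' b < 0" using le by auto
    then have "u b - u a < 0" "0 < u b"
      using \<xi>(2) sgn(2) \<alpha> ab by (auto simp: mult_neg_pos zero_less_mult_iff)
    then show False using \<open>\<not> 0 \<le> u a\<close> by simp
  qed
  moreover have "0 \<le> u b"
  proof (rule ccontr)
    assume "\<not> 0 \<le> u b"
    then have "0 < u' b" using sgn(2) \<alpha> by (simp add: mult_less_0_iff)
    then have "0 < u' \<xi>" using le by auto
    then have "0 < u b - u a" using \<xi>(2) ab by simp
    then show False using \<open>\<not> 0 \<le> u b\<close> \<open>0 \<le> u a\<close> by simp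
  qed
  moreover have "min (u a) (u b) \<le> u x"
    using x by (intro antitone_derivative_quasiconcave[OF u dec]) auto
  ultimately show ?thesis by auto
qed

lemma robin_rearrangement_comparison:
  fixes f u v :: "real \<Rightarrow> real"
  assumes L: "0 < L" and \<alpha>: "0 < \<alpha>"
    and f: "set_integrable lebesgue {-L..L} f" "AE x in lebesgue_on {-L..L}. 0 \<le> f x"
    and u: "robin_poisson_solution (-L) L \<alpha> (\<lambda>x. ereal (f x)) u"
    and v: "robin_poisson_solution (-L) L \<alpha> (symmetric_decreasing_rearrangement {-L..L} f) v"
  shows "continuous_on {-L..L} u" "continuous_on {-L..L} v"
    and "\<And>x. x \<in> {-L..L} \<Longrightarrow> 0 \<le> u x" "\<And>x. x \<in> {-L..L} \<Longrightarrow> 0 \<le> v x"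
    and "\<And>c. integral {-L..L} (\<lambda>x. max (u x - c) 0) \<le> integral {-L..L} (\<lambda>x. max (v x - c) 0)"
proof -
  define g where "g = (\<lambda>x. real_of_ereal (symmetric_decreasing_rearrangement {-L..L} f x))"
  note g = symmetric_rearrangement_interval[OF L f, folded g_def]
  obtain u' where u': "\<forall>x\<in>{-L..L}. (u has_real_derivative u' x) (at x within {-L..L})"
    "continuous_on {-L..L} u'" "- u' (-L) + \<alpha> * u (-L) = 0" "u' L + \<alpha> * u L = 0"
    "\<And>x y. \<lbrakk>-L \<le> x; x \<le> y; y \<le> L\<rbrakk> \<Longrightarrow> (f has_integral (u' x - u' y)) {x..y}"
    using robin_poisson_solutionE[OF u] by (auto simp: real_of_ereal.simps)
  obtain v' where v': "\<forall>x\<in>{-L..L}. (v has_real_derivative v' x) (at x within {-L..L})"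
    "continuous_on {-L..L} v'" "- v' (-L) + \<alpha> * v (-L) = 0" "v' L + \<alpha> * v L = 0"
    "\<And>x y. \<lbrakk>-L \<le> x; x \<le> y; y \<le> L\<rbrakk> \<Longrightarrow> (g has_integral (v' x - v' y)) {x..y}"
    using robin_poisson_solutionE[OF v, folded g_def] by blast
  have u_dec: "u' y \<le> u' x" if "-L \<le> x" "x \<le> y" "y \<le> L" for x y
  proof -
    have "AE t in lebesgue. t \<in> {-L..L} \<longrightarrow> 0 \<le> f t"
      using f(2) by (simp add: AE_restrict_space_iff)
    then have "AE t in lebesgue. t \<in> {x..y} \<longrightarrow> 0 \<le> f t"
      by eventually_elim (use that in auto)
    from has_integral_nonneg_AE[OF u'(5)[OF that] this] show ?thesis by simp
  qed
  have v_dec: "v' y \<le> v' x" if "-L \<le> x" "x \<le> y" "y \<le> L" for x y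
  proof -
    (* at 0 and at the end points the rearrangement takes essential bounds, possibly infinite *)
    have "AE t in lebesgue. t \<notin> {0, L, -L}"
      by (intro AE_not_in) (simp add: negligible_finite flip: negligible_iff_null_sets)
    then have "AE t in lebesgue. t \<in> {x..y} \<longrightarrow> 0 \<le> g t"
    proof eventually_elim
      case (elim t)
      show ?case
      proof
        assume "t \<in> {x..y}"
        with elim that have "0 < \<bar>t\<bar>" "\<bar>t\<bar> < L" by auto
        from g(1)[OF this] show "0 \<le> g t" unfolding g_def by (rule conjunct2)
      qed
    qed
    from has_integral_nonneg_AE[OF v'(5)[OF that] this] show ?thesis by simp
  qed
  have conc: "u' x - u' y \<le> v' (- ((y - x) / 2)) - v' ((y - x) / 2)"
    if "-L \<le> x" "x \<le> y" "y \<le> L" for x y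
  proof -
    define h where "h = (y - x) / 2"
    have "2 * h = y - x" by (simp add: h_def)
    then have "-L \<le> -h" "-h \<le> h" "h \<le> L" using that by linarith+
    then have "integral {-h..h} g = v' (-h) - v' h" using v'(5) by (intro integral_unique) blast
    moreover have "integral {x..y} f = u' x - u' y" using u'(5)[OF that] by (rule integral_unique)
    ultimately show ?thesis using g(3)[OF that] by (simp only: h_def)
  qed
  have total: "u' (-L) - u' L = v' (-L) - v' L"
    using g(2) integral_unique[OF u'(5)[of "-L" L]] integral_unique[OF v'(5)[of "-L" L]] L by simp
  show cu: "continuous_on {-L..L} u" and cv: "continuous_on {-L..L} v"
    using u'(1) v'(1) by (auto intro!: DERIV_continuous_on)
  have L2: "-L < L" using L by simp
  show "0 \<le> u x" if "x \<in> {-L..L}" for x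
    by (rule robin_nonneg[OF L2 \<alpha> u'(1) u'(3) u'(4) u_dec that])
  show "0 \<le> v x" if "x \<in> {-L..L}" for x
    by (rule robin_nonneg[OF L2 \<alpha> v'(1) v'(3) v'(4) v_dec that])
  show "integral {-L..L} (\<lambda>x. max (u x - c) 0) \<le> integral {-L..L} (\<lambda>x. max (v x - c) 0)" for c
  proof (rule integral_pos_part_le_of_interval_comparison[OF cu cv])
    show "min (u x) (u z) \<le> u y" if "-L \<le> x" "x \<le> y" "y \<le> z" "z \<le> L" for x y z
      by (rule antitone_derivative_quasiconcave[OF u'(1) u_dec that])
    show "integral {s - r..s + r} u \<le> integral {-r..r} v" if "0 \<le> r" "-L \<le> s - r" "s + r \<le> L" for s r
      by (rule robin_interval_comparison[OF L \<alpha> u'(1-4) v'(1-4) v_dec conc total that])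
  qed
qed

theorem theorem1p3:
  fixes f u v :: "real \<Rightarrow> real" and \<alpha> :: real
  assumes "set_integrable lebesgue {-pi..pi} f"
    and "AE x in lebesgue_on {-pi..pi}. 0 \<le> f x"
    and "\<alpha> > 0"
    and "robin_poisson_solution (-pi) pi \<alpha> (\<lambda>x. ereal (f x)) u"
    and "robin_poisson_solution (-pi) pi \<alpha>
           (symmetric_decreasing_rearrangement {-pi..pi} f) v"
  shows "(\<forall>\<phi> :: real \<Rightarrow> real. mono \<phi> \<longrightarrow> convex_on UNIV \<phi> \<longrightarrow>
            (LINT x:{-pi..pi}|lebesgue. \<phi> (u x)) \<le> (LINT x:{-pi..pi}|lebesgue. \<phi> (v x)))
       \<and> (\<forall>p :: ennreal. 1 \<le> p \<longrightarrow> Lp_norm_on {-pi..pi} p u \<le> Lp_norm_on {-pi..pi} p v)"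
proof -
  note c = robin_rearrangement_comparison[OF pi_gt_zero assms(3,1,2,4,5)]
  have \<phi>_le: "integral {-pi..pi} (\<lambda>x. \<phi> (u x)) \<le> integral {-pi..pi} (\<lambda>x. \<phi> (v x))"
    if "mono \<phi>" "convex_on UNIV \<phi>" for \<phi>
    by (rule integral_increasing_convex_le[OF c(1,2,5) that])
  have HK: "(LINT x:{-pi..pi}|lebesgue. \<phi> (w x)) = integral {-pi..pi} (\<lambda>x. \<phi> (w x))"
    if "convex_on UNIV \<phi>" "continuous_on {-pi..pi} w" for \<phi> w :: "real \<Rightarrow> real"
  proof -
    have "continuous_on {-pi..pi} (\<lambda>x. \<phi> (w x))"
      by (rule continuous_on_compose2[OF convex_on_continuous[OF open_UNIV that(1)] that(2)]) simp
    then show ?thesis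
      by (intro set_lebesgue_integral_eq_integral(2) absolutely_integrable_continuous_real)
  qed
  have "Lp_norm_on {-pi..pi} p u \<le> Lp_norm_on {-pi..pi} p v" if "1 \<le> p" for p
  proof (cases "p = \<infinity>")
    case True
    then show ?thesis using Lp_norm_on_mono_infinity[OF _ c(1,2,3,5)] by simp
  next
    case False
    then have "p < \<infinity>" by (simp add: less_top)
    with that show ?thesis by (intro Lp_norm_on_mono_finite c(1-4) \<phi>_le)
  qed
  then show ?thesis using \<phi>_le HK c(1,2) by auto
qed

end
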